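(* Let $Q(x,y)\in\mathbb{R}[x,y]$ and let $\mathcal{S}_L(Q)$ be the set of all non-degenerate regular tubular surfaces in Lorentzian $3$-space whose Gaussian curvature $K$ and mean curvature $H$ satisfy $Q(K,H)\equiv0$. For $\varepsilon\in\{-1,1\}$ put $$Rad_{L,\varepsilon}(Q)=\{r\in(0,+\infty)\,:\,Q(0,\tfrac{\varepsilon}{2r})=0\},\qquad Rad^{*}_{L,\varepsilon}(Q)=\{r\in Rad_{L,\varepsilon}(Q)\,:\,Q(x,y)\in\langle xr^2-2ry+\varepsilon\rangle\}.$$ Then the elements of $\mathcal{S}_L(Q)$ are exactly: (i) the right cylinders with signal $\varepsilon\in\{-1,1\}$ and radius in $Rad_{L,\varepsilon}(Q)$; and (ii) the regular tubular surfaces with signal $\varepsilon\in\{-1,1\}$ and radius in $Rad^{*}_{L,\varepsilon}(Q)$.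
   Context: $\langle\varphi\rangle$ denotes the ideal of $\mathbb{R}[x,y]$ generated by $\varphi$. Lorentzian $3$-space $\mathbb{L}^3$ is $\mathbb{R}^3$ with $\langle u,v\rangle_1=u_1v_1+u_2v_2-u_3v_3$. Let $\gamma:(a,b)\to\mathbb{L}^3$ be a smooth curve parametrized by arc length which is spacelike or timelike, i.e. $\varepsilon_T:=\langle\gamma',\gamma'\rangle_1$ is constantly $1$ or constantly $-1$ (the central curve). Let $r>0$ and $\varepsilon\in\{-1,1\}$. The tubular surface of radius $r$ around $\gamma$ with signal $\varepsilon$ is the union over $s\in(a,b)$ of the normal sections $$S_r(\gamma(s))=\{x:\ \langle x-\gamma(s),\gamma'(s)\rangle_1=0,\ \langle x-\gamma(s),x-\gamma(s)\rangle_1=\varepsilon r^2\},$$ which are called Lorentzian circles if $\varepsilon=1$ and Lorentzian hyperboles if $\varepsilon=-1$ (the latter occur only when $\gamma$ is spacelike); when the sections have two branches, the surface may also consist of just one branch, chosen continuously in $s$. The surface is parametrized by pairs $(s,v)$, $v=x-\gamma(s)$. It is regular if $1-\varepsilon_T\langle\gamma''(s),v\rangle_1\neq0$ for all its pairs $(s,v)$; the parametrization is then an immersion and the surface is non-degenerate (spacelike or timelike). Its unit normal is $\mathcal{N}=-v/r$, so $\langle\mathcal{N},\mathcal{N}\rangle_1=\varepsilon$ (the signal). With $\psi$ a local parametrization in coordinates $(s,t)$, $E=\langle\psi_s,\psi_s\rangle_1$, $F=\langle\psi_s,\psi_t\rangle_1$, $G=\langle\psi_t,\psi_t\rangle_1$,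 $e=\langle\psi_{ss},\mathcal{N}\rangle_1$, $f=\langle\psi_{st},\mathcal{N}\rangle_1$, $g=\langle\psi_{tt},\mathcal{N}\rangle_1$, the Gaussian and mean curvatures are $$K=\varepsilon\frac{eg-f^2}{EG-F^2},\qquad H=\varepsilon\frac{eG-2fF+gE}{2(EG-F^2)}.$$ A right cylinder is a regular tubular surface whose central curve is a geodesic, i.e. $\gamma''\equiv0$. *)

theory Defs
  imports "HOL-Analysis.Analysis" "HOL-Computational_Algebra.Polynomial"
begin

section \<open>Bivariate real polynomials\<close>

text \<open>
  \<open>\<real>[x,y]\<close> is \<open>\<real>[x][y]\<close>: the outer indeterminate is \<open>y\<close>, the coefficients are polynomials in \<open>x\<close>.
\<close>

definition eval2 :: "real poly poly \<Rightarrow> real \<Rightarrow> real \<Rightarrow> real" where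
  "eval2 Q x y = poly (poly Q [:y:]) x"

definition const2 :: "real \<Rightarrow> real poly poly" where
  "const2 c = [:[:c:]:]"

definition var_x :: "real poly poly" where
  "var_x = [:[:0, 1:]:]"

definition var_y :: "real poly poly" where
  "var_y = [:0, 1:]"

definition principal_ideal :: "'a::comm_ring_1 \<Rightarrow> 'a set" where
  "principal_ideal \<phi> = {p * \<phi> | p. True}"

lemma eval2_simps [simp]:
  "eval2 (const2 c) x y = c" "eval2 var_x x y = x" "eval2 var_y x y = y"
  "eval2 (P + Q) x y = eval2 P x y + eval2 Q x y"
  "eval2 (P - Q) x y = eval2 P x y - eval2 Q x y"
  "eval2 (P * Q) x y = eval2 P x y * eval2 Q x y"
  by (simp_all add: eval2_def const2_def var_x_def var_y_def)

definition Rad_L :: "real \<Rightarrow> real poly poly \<Rightarrow> real set" where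
  "Rad_L \<epsilon> Q = {r. 0 < r \<and> eval2 Q 0 (\<epsilon> / (2 * r)) = 0}"

definition Rad_L_star :: "real \<Rightarrow> real poly poly \<Rightarrow> real set" where
  "Rad_L_star \<epsilon> Q =
     {r \<in> Rad_L \<epsilon> Q.
        Q \<in> principal_ideal (var_x * const2 (r\<^sup>2) - const2 (2 * r) * var_y + const2 \<epsilon>)}"


section \<open>Smooth maps, partial derivatives, Lorentzian product\<close>

text \<open>Both notions below are used for open \<open>S\<close> only.\<close>

primrec Ck_on :: "nat \<Rightarrow> 'a::real_normed_vector set \<Rightarrow> ('a \<Rightarrow> 'b::real_normed_vector) \<Rightarrow> bool" where
  "Ck_on 0 S f \<longleftrightarrow> continuous_on S f"
| "Ck_on (Suc n) S f \<longleftrightarrow>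
     (\<forall>x\<in>S. f differentiable (at x)) \<and> (\<forall>h. Ck_on n S (\<lambda>x. frechet_derivative f (at x) h))"

definition smooth_on :: "'a::real_normed_vector set \<Rightarrow> ('a \<Rightarrow> 'b::real_normed_vector) \<Rightarrow> bool" where
  "smooth_on S f \<longleftrightarrow> (\<forall>n. Ck_on n S f)"

definition vderiv :: "(real \<Rightarrow> 'b::real_normed_vector) \<Rightarrow> real \<Rightarrow> 'b" where
  "vderiv f s = vector_derivative f (at s)"

definition pd1 :: "(real \<times> real \<Rightarrow> 'b::real_normed_vector) \<Rightarrow> real \<times> real \<Rightarrow> 'b" where
  "pd1 f z = vector_derivative (\<lambda>s. f (s, snd z)) (at (fst z))"

definition pd2 :: "(real \<times> real \<Rightarrow> 'b::real_normed_vector) \<Rightarrow> real \<times> real \<Rightarrow> 'b" where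
  "pd2 f z = vector_derivative (\<lambda>t. f (fst z, t)) (at (snd z))"

definition lor :: "real^3 \<Rightarrow> real^3 \<Rightarrow> real" where
  "lor u v = u$1 * v$1 + u$2 * v$2 - u$3 * v$3"


section \<open>Tubular surfaces\<close>

text \<open>
  A tubular surface is an immersed surface given together with its central curve, radius and signal;
  its points are the pairs \<open>(s, v)\<close>, standing for the point \<open>\<gamma>(s) + v\<close> of the ambient space. The
  central curve is defined on the open interval \<open>(lower, upper)\<close>, possibly unbounded; the values of
  \<open>curve\<close> outside of it are irrelevant. The component \<open>pairs\<close> records which branches are taken.
\<close>

record tube =
  lower :: ereal
  upper :: ereal
  curve :: "real \<Rightarrow> real^3"
  radius :: real
  signal :: real
  pairs :: "(real \<times> (real^3)) set"

definition dom_of :: "tube \<Rightarrow> real set" where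
  "dom_of S = einterval (lower S) (upper S)"

definition tangent :: "tube \<Rightarrow> real \<Rightarrow> real^3" where
  "tangent S = vderiv (curve S)"

definition accel :: "tube \<Rightarrow> real \<Rightarrow> real^3" where
  "accel S = vderiv (vderiv (curve S))"

definition spacelike_curve :: "tube \<Rightarrow> bool" where
  "spacelike_curve S \<longleftrightarrow> (\<forall>s\<in>dom_of S. lor (tangent S s) (tangent S s) = 1)"

definition timelike_curve :: "tube \<Rightarrow> bool" where
  "timelike_curve S \<longleftrightarrow> (\<forall>s\<in>dom_of S. lor (tangent S s) (tangent S s) = -1)"

text \<open>The normal section at parameter \<open>s\<close>, translated by \<open>- \<gamma>(s)\<close>.\<close>

definition normal_section :: "tube \<Rightarrow> real \<Rightarrow> (real^3) set" where
  "normal_section S s =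
     {v. lor v (tangent S s) = 0 \<and> lor v v = signal S * (radius S)\<^sup>2}"

text \<open>
  The branches of a normal section are its connected components. A choice of one branch for each \<open>s\<close>
  is continuous if the chosen branches contain the values of a continuous map \<open>\<sigma>\<close>. If \<open>\<gamma>\<close> is
  timelike, the sections are connected and the two disjuncts on \<open>pairs\<close> agree. Sections with
  signal \<open>-1\<close> around a timelike curve are empty, hence the condition on the signal.
\<close>

definition tubular_surface :: "tube \<Rightarrow> bool" where
  "tubular_surface S \<longleftrightarrow>
     lower S < upper S \<and>
     smooth_on (dom_of S) (curve S) \<and>
     (spacelike_curve S \<or> timelike_curve S) \<and>
     0 < radius S \<and>
     signal S \<in> {-1, 1} \<and>
     (signal S = -1 \<longrightarrow> spacelike_curve S) \<and>
     (pairs S = (SIGMA s:dom_of S. normal_section S s) \<or>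
      (\<exists>\<sigma>. continuous_on (dom_of S) \<sigma> \<and>
           (\<forall>s\<in>dom_of S. \<sigma> s \<in> normal_section S s) \<and>
           pairs S = (SIGMA s:dom_of S. connected_component_set (normal_section S s) (\<sigma> s))))"

text \<open>The factor \<open>lor (tangent S s) (tangent S s)\<close> is the constant \<open>\<epsilon>\<^sub>T\<close>.\<close>

definition regular_tubular :: "tube \<Rightarrow> bool" where
  "regular_tubular S \<longleftrightarrow> tubular_surface S \<and>
     (\<forall>(s, v)\<in>pairs S. 1 - lor (tangent S s) (tangent S s) * lor (accel S s) v \<noteq> 0)"

definition right_cylinder :: "tube \<Rightarrow> bool" where
  "right_cylinder S \<longleftrightarrow> regular_tubular S \<and> (\<forall>s\<in>dom_of S. accel S s = 0)"


section \<open>Fundamental forms and curvatures\<close>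

text \<open>
  A local parametrization in coordinates \<open>(s, t)\<close>: the first coordinate is the parameter of the
  central curve, and the point \<open>\<psi>(s, t)\<close> lies over \<open>\<gamma>(s)\<close>.
\<close>

definition local_param :: "tube \<Rightarrow> (real \<times> real) set \<Rightarrow> (real \<times> real \<Rightarrow> real^3) \<Rightarrow> bool" where
  "local_param S V \<psi> \<longleftrightarrow> open V \<and> smooth_on V \<psi> \<and>
     (\<forall>z\<in>V. (fst z, \<psi> z - curve S (fst z)) \<in> pairs S \<and> inj (frechet_derivative \<psi> (at z)))"

definition unit_normal :: "tube \<Rightarrow> (real \<times> real \<Rightarrow> real^3) \<Rightarrow> real \<times> real \<Rightarrow> real^3" where
  "unit_normal S \<psi> z = - ((\<psi> z - curve S (fst z)) /\<^sub>R radius S)"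

definition ff_E :: "(real \<times> real \<Rightarrow> real^3) \<Rightarrow> real \<times> real \<Rightarrow> real" where
  "ff_E \<psi> z = lor (pd1 \<psi> z) (pd1 \<psi> z)"

definition ff_F :: "(real \<times> real \<Rightarrow> real^3) \<Rightarrow> real \<times> real \<Rightarrow> real" where
  "ff_F \<psi> z = lor (pd1 \<psi> z) (pd2 \<psi> z)"

definition ff_G :: "(real \<times> real \<Rightarrow> real^3) \<Rightarrow> real \<times> real \<Rightarrow> real" where
  "ff_G \<psi> z = lor (pd2 \<psi> z) (pd2 \<psi> z)"

definition sf_e :: "tube \<Rightarrow> (real \<times> real \<Rightarrow> real^3) \<Rightarrow> real \<times> real \<Rightarrow> real" where
  "sf_e S \<psi> z = lor (pd1 (pd1 \<psi>) z) (unit_normal S \<psi> z)"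

definition sf_f :: "tube \<Rightarrow> (real \<times> real \<Rightarrow> real^3) \<Rightarrow> real \<times> real \<Rightarrow> real" where
  "sf_f S \<psi> z = lor (pd2 (pd1 \<psi>) z) (unit_normal S \<psi> z)"

definition sf_g :: "tube \<Rightarrow> (real \<times> real \<Rightarrow> real^3) \<Rightarrow> real \<times> real \<Rightarrow> real" where
  "sf_g S \<psi> z = lor (pd2 (pd2 \<psi>) z) (unit_normal S \<psi> z)"

definition gauss_in :: "tube \<Rightarrow> (real \<times> real \<Rightarrow> real^3) \<Rightarrow> real \<times> real \<Rightarrow> real" where
  "gauss_in S \<psi> z =
     signal S * ((sf_e S \<psi> z * sf_g S \<psi> z - (sf_f S \<psi> z)\<^sup>2) /
                 (ff_E \<psi> z * ff_G \<psi> z - (ff_F \<psi> z)\<^sup>2))"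

definition mean_in :: "tube \<Rightarrow> (real \<times> real \<Rightarrow> real^3) \<Rightarrow> real \<times> real \<Rightarrow> real" where
  "mean_in S \<psi> z =
     signal S *
       ((sf_e S \<psi> z * ff_G \<psi> z - 2 * sf_f S \<psi> z * ff_F \<psi> z + sf_g S \<psi> z * ff_E \<psi> z) /
        (2 * (ff_E \<psi> z * ff_G \<psi> z - (ff_F \<psi> z)\<^sup>2)))"

definition param_at ::
    "tube \<Rightarrow> real \<times> (real^3) \<Rightarrow> (real \<times> real \<Rightarrow> real^3) \<Rightarrow> real \<times> real \<Rightarrow> bool" where
  "param_at S p \<psi> z \<longleftrightarrow>
     (\<exists>V. local_param S V \<psi> \<and> z \<in> V \<and> (fst z, \<psi> z - curve S (fst z)) = p)"

text \<open>The value at a point does not depend on the local parametrization in which it is computed.\<close>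

definition gauss_curvature :: "tube \<Rightarrow> real \<times> (real^3) \<Rightarrow> real" where
  "gauss_curvature S p = (THE k. \<exists>\<psi> z. param_at S p \<psi> z \<and> k = gauss_in S \<psi> z)"

definition mean_curvature :: "tube \<Rightarrow> real \<times> (real^3) \<Rightarrow> real" where
  "mean_curvature S p = (THE k. \<exists>\<psi> z. param_at S p \<psi> z \<and> k = mean_in S \<psi> z)"

definition non_degenerate :: "tube \<Rightarrow> bool" where
  "non_degenerate S \<longleftrightarrow>
     (\<forall>V \<psi>. local_param S V \<psi> \<longrightarrow> (\<forall>z\<in>V. ff_E \<psi> z * ff_G \<psi> z - (ff_F \<psi> z)\<^sup>2 \<noteq> 0))"

definition S_L :: "real poly poly \<Rightarrow> tube set" where
  "S_L Q = {S. regular_tubular S \<and> non_degenerate S \<and>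
               (\<forall>p\<in>pairs S. eval2 Q (gauss_curvature S p) (mean_curvature S p) = 0)}"

end

theory Submission
  imports Defs
begin

text \<open>
  Put \<open>w = 1 - \<epsilon>\<^sub>T \<langle>\<gamma>'', v\<rangle>\<close>. As \<open>\<psi>\<^sub>s\<close> and \<open>\<psi>\<^sub>t\<close> are orthogonal to \<open>v\<close>, and \<open>\<psi>\<^sub>t\<close> also to \<open>\<gamma>'\<close>, one finds
  \<open>EG - F\<^sup>2 = \<epsilon>\<^sub>T w\<^sup>2 G\<close>, \<open>e = (E - \<epsilon>\<^sub>T w) / r\<close>, \<open>f = F / r\<close> and \<open>g = G / r\<close>, whence
  \<open>K = \<epsilon> (1 - 1/w) / r\<^sup>2\<close> and \<open>H = \<epsilon> (2 - 1/w) / (2 r)\<close> in every local parametrization. Hence \<open>(K, H)\<close> lies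
  on the line \<open>x r\<^sup>2 - 2 r y + \<epsilon> = 0\<close>, and it is the point \<open>(0, \<epsilon> / (2 r))\<close> where \<open>\<gamma>'' = 0\<close>. Where \<open>\<gamma>'' \<noteq> 0\<close>, \<open>w\<close> takes
  infinitely many values on each branch of the normal section, so \<open>Q\<close> vanishes at infinitely many
  points of the line and is a multiple of its equation. Since the curvatures are defined by a
  definite description, this also needs a local parametrization at every point of the surface.
\<close>

section \<open>Calculus of smooth maps\<close>

text \<open>A derivative at a point of the open set \<open>S\<close> depends only on the values
  nearby, so \<open>f\<close> and \<open>g\<close> have the same derivatives on \<open>S\<close> and
  the induction passes to them.\<close>

lemma Ck_on_cong:
  assumes "open S" "\<And>x. x \<in> S \<Longrightarrow> f x = g x"
  shows "Ck_on n S f \<longleftrightarrow> Ck_on n S g"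
  using assms(2)
proof (induction n arbitrary: f g)
  case 0
  then show ?case by (simp cong: continuous_on_cong)
next
  case (Suc n)
  have D: "(f has_derivative D) (at x) \<longleftrightarrow> (g has_derivative D) (at x)" if "x \<in> S" for x D
    using has_derivative_transform_within_open[OF _ assms(1) that] Suc.prems by metis
  then have "frechet_derivative f (at x) = frechet_derivative g (at x)" if "x \<in> S" for x
    using that by (simp add: frechet_derivative_def)
  then have "Ck_on n S (\<lambda>x. frechet_derivative f (at x) h) \<longleftrightarrow>
      Ck_on n S (\<lambda>x. frechet_derivative g (at x) h)" for h
    by (intro Suc.IH) simp
  moreover have "f differentiable (at x) \<longleftrightarrow> g differentiable (at x)" if "x \<in> S" for x
    using D[OF that] by (simp add: differentiable_def)
  ultimately show ?case by simp
qed

text \<open>\<open>frechet_derivative\<close> is defined by choice; uniqueness of the derivative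
  allows any explicit \<open>f'\<close> in its place.\<close>

lemma Ck_on_SucI:
  assumes "open S" "\<And>x. x \<in> S \<Longrightarrow> (f has_derivative f' x) (at x)"
    and "\<And>h. Ck_on n S (\<lambda>x. f' x h)"
  shows "Ck_on (Suc n) S f"
proof -
  have "Ck_on n S (\<lambda>x. frechet_derivative f (at x) h)" for h
    using assms(3)[of h]
    by (subst Ck_on_cong[OF assms(1)]) (simp_all add: frechet_derivative_at[OF assms(2), symmetric])
  with assms(2) show ?thesis by (auto simp: differentiable_def)
qed

lemma Ck_on_Suc_has_derivative:
  assumes "Ck_on (Suc n) S f" "x \<in> S"
  shows "(f has_derivative frechet_derivative f (at x)) (at x)"
  using assms by (intro frechet_derivative_works[THEN iffD1]) simp

text \<open>\<open>Ck_on\<close> asks for continuity only at the top order; below it, continuity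
  comes from differentiability, which is the base case.\<close>

lemma Ck_on_SucD: "Ck_on (Suc n) S f \<Longrightarrow> Ck_on n S f"
proof (induction n arbitrary: f)
  case 0
  then show ?case
    by (auto intro!: continuous_at_imp_continuous_on differentiable_imp_continuous_within)
next
  case (Suc n)
  have "Ck_on (Suc n) S (\<lambda>x. frechet_derivative f (at x) h)" for h
    using Suc.prems Ck_on.simps(2)[of "Suc n" S f] by blast
  then have "Ck_on n S (\<lambda>x. frechet_derivative f (at x) h)" for h
    by (rule Suc.IH)
  with Suc.prems show ?case
    unfolding Ck_on.simps(2)[of "Suc n" S f] Ck_on.simps(2)[of n S f] by blast
qed

lemma Ck_on_const: "Ck_on n S (\<lambda>x. c)"
  by (induction n arbitrary: c) simp_all

lemma Ck_on_bounded_linear: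
  assumes "open S" "bounded_linear L"
  shows "Ck_on n S L"
proof (cases n)
  case 0
  with assms(2) show ?thesis by (simp add: linear_continuous_on)
next
  case (Suc m)
  show ?thesis unfolding Suc
    by (rule Ck_on_SucI[where f' = "\<lambda>x. L", OF assms(1)])
      (auto intro: bounded_linear_imp_has_derivative assms(2) Ck_on_const)
qed

lemma Ck_on_add:
  assumes "open S" "Ck_on n S f" "Ck_on n S g"
  shows "Ck_on n S (\<lambda>x. f x + g x)"
  using assms(2,3)
proof (induction n arbitrary: f g)
  case 0
  then show ?case by (simp add: continuous_on_add)
next
  case (Suc n)
  show ?case
  proof (rule Ck_on_SucI[OF assms(1)])
    show "((\<lambda>x. f x + g x) has_derivative
        (\<lambda>h. frechet_derivative f (at x) h + frechet_derivative g (at x) h)) (at x)" if "x \<in> S" for x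
      using Suc.prems that by (intro has_derivative_add Ck_on_Suc_has_derivative)
    show "Ck_on n S (\<lambda>x. frechet_derivative f (at x) h + frechet_derivative g (at x) h)" for h
      using Suc.prems by (intro Suc.IH) simp_all
  qed
qed

text \<open>By the product rule the derivative is a sum of two such products, one factor being
  differentiated in each, so the induction closes. One proof covers \<open>*\<close>,
  \<open>*\<^sub>R\<close>, \<open>lor\<close> and \<open>lcross\<close>.\<close>

lemma (in bounded_bilinear) Ck_on:
  assumes "open S" "Ck_on n S f" "Ck_on n S g"
  shows "Ck_on n S (\<lambda>x. prod (f x) (g x))"
  using assms(2,3)
proof (induction n arbitrary: f g)
  case 0
  then show ?case by (simp add: continuous_on)
next
  case (Suc n)
  show ?case
  proof (rule Ck_on_SucI[OF assms(1)])
    show "((\<lambda>x. prod (f x) (g x)) has_derivative (\<lambda>h. prod (f x) (frechet_derivative g (at x) h) +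
        prod (frechet_derivative f (at x) h) (g x))) (at x)" if "x \<in> S" for x
      using Suc.prems that by (intro FDERIV Ck_on_Suc_has_derivative)
    show "Ck_on n S (\<lambda>x. prod (f x) (frechet_derivative g (at x) h) +
        prod (frechet_derivative f (at x) h) (g x))" for h
      using Suc.prems Ck_on_SucD[of n S f] Ck_on_SucD[of n S g]
      by (intro Ck_on_add Suc.IH assms(1)) simp_all
  qed
qed

text \<open>For a real-valued inner map the chain rule is a scalar product
  \<open>g' *\<^sub>R f'(g)\<close>, so the bilinear case carries the induction.\<close>

lemma Ck_on_compose_real:
  fixes f :: "real \<Rightarrow> 'b::real_normed_vector"
  assumes "open S" "open U" "g ` S \<subseteq> U" "Ck_on n U f" "Ck_on n S g"
  shows "Ck_on n S (\<lambda>x. f (g x))"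
  using assms(4,5)
proof (induction n arbitrary: f)
  case 0
  then show ?case using assms(3) by (auto intro: continuous_on_compose2)
next
  case (Suc n)
  show ?case
  proof (rule Ck_on_SucI[OF assms(1)])
    fix x assume x: "x \<in> S"
    then have f: "(f has_derivative frechet_derivative f (at (g x))) (at (g x))"
      using Suc.prems(1) assms(3) by (intro Ck_on_Suc_has_derivative) auto
    have "frechet_derivative f (at (g x)) y = y *\<^sub>R frechet_derivative f (at (g x)) 1" for y
      using linear_cmul[OF has_derivative_linear[OF f], of y 1] by simp
    then have "(\<lambda>h. frechet_derivative f (at (g x)) (frechet_derivative g (at x) h)) =
        (\<lambda>h. frechet_derivative g (at x) h *\<^sub>R frechet_derivative f (at (g x)) 1)"
      by (rule ext)
    with has_derivative_compose[OF Ck_on_Suc_has_derivative[OF Suc.prems(2) x] f] show "((\<lambda>x. f (g x)) has_derivative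
        (\<lambda>h. frechet_derivative g (at x) h *\<^sub>R frechet_derivative f (at (g x)) 1)) (at x)"
      by (simp only:)
  next
    fix h
    have "Ck_on n S g" using Suc.prems(2) by (rule Ck_on_SucD)
    then show "Ck_on n S (\<lambda>x. frechet_derivative g (at x) h *\<^sub>R frechet_derivative f (at (g x)) 1)"
      using Suc.prems
      by (intro bounded_bilinear.Ck_on[OF bounded_bilinear_scaleR] Suc.IH assms(1)) simp_all
  qed
qed

lemma smooth_on_cong:
  assumes "open S" "\<And>x. x \<in> S \<Longrightarrow> f x = g x"
  shows "smooth_on S f \<longleftrightarrow> smooth_on S g"
  by (simp add: smooth_on_def Ck_on_cong[OF assms])

lemma smooth_on_const: "smooth_on S (\<lambda>x. c)"
  by (simp add: smooth_on_def Ck_on_const)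

lemma smooth_on_bounded_linear: "open S \<Longrightarrow> bounded_linear L \<Longrightarrow> smooth_on S L"
  by (simp add: smooth_on_def Ck_on_bounded_linear)

lemma smooth_on_add:
  "open S \<Longrightarrow> smooth_on S f \<Longrightarrow> smooth_on S g \<Longrightarrow> smooth_on S (\<lambda>x. f x + g x)"
  by (simp add: smooth_on_def Ck_on_add)

lemma (in bounded_bilinear) smooth_on:
  "open S \<Longrightarrow> smooth_on S f \<Longrightarrow> smooth_on S g \<Longrightarrow> smooth_on S (\<lambda>x. prod (f x) (g x))"
  by (simp add: smooth_on_def Ck_on)

lemmas smooth_on_scaleR = bounded_bilinear.smooth_on[OF bounded_bilinear_scaleR]

lemma smooth_on_compose_real:
  fixes f :: "real \<Rightarrow> 'b::real_normed_vector"
  assumes "open S" "open U" "g ` S \<subseteq> U" "smooth_on U f" "smooth_on S g"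
  shows "smooth_on S (\<lambda>x. f (g x))"
  using assms(4,5) unfolding smooth_on_def by (blast intro: Ck_on_compose_real[OF assms(1-3)])

lemma smooth_on_subset:
  assumes "smooth_on S f" "U \<subseteq> S"
  shows "smooth_on U f"
proof -
  have "Ck_on n S f \<Longrightarrow> Ck_on n U f" for n
    using assms(2) by (induction n arbitrary: f) (auto intro: continuous_on_subset)
  with assms(1) show ?thesis by (auto simp: smooth_on_def)
qed

lemma smooth_on_has_derivative:
  "smooth_on S f \<Longrightarrow> x \<in> S \<Longrightarrow> (f has_derivative frechet_derivative f (at x)) (at x)"
  using Ck_on_Suc_has_derivative unfolding smooth_on_def by blast

lemma smooth_on_frechet_derivative:
  assumes "smooth_on S f"
  shows "smooth_on S (\<lambda>x. frechet_derivative f (at x) h)"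
  unfolding smooth_on_def
proof
  fix n
  have "Ck_on (Suc n) S f" using assms by (simp only: smooth_on_def)
  then show "Ck_on n S (\<lambda>x. frechet_derivative f (at x) h)" by simp
qed

lemma smooth_on_imp_continuous_on: "smooth_on S f \<Longrightarrow> continuous_on S f"
  unfolding smooth_on_def using Ck_on.simps(1) by blast

section \<open>Smooth functions of one real variable\<close>

lemma smooth_on_has_vector_derivative:
  fixes f :: "real \<Rightarrow> 'b::real_normed_vector"
  assumes "smooth_on S f" "x \<in> S"
  shows "(f has_vector_derivative vderiv f x) (at x)"
  using smooth_on_has_derivative[OF assms] unfolding vderiv_def
  by (metis differentiableI vector_derivative_works)

lemma smooth_on_vderiv:
  fixes f :: "real \<Rightarrow> 'b::real_normed_vector"
  assumes "open S" "smooth_on S f"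
  shows "smooth_on S (vderiv f)"
proof -
  have "vderiv f x = frechet_derivative f (at x) 1" if "x \<in> S" for x
    using frechet_derivative_at[OF smooth_on_has_vector_derivative[OF assms(2) that, unfolded has_vector_derivative_def]]
    by (metis scaleR_one)
  then show ?thesis
    using smooth_on_frechet_derivative[OF assms(2)] by (subst smooth_on_cong[OF assms(1)])
qed

text \<open>A family closed under differentiation up to constant factors is smooth, by induction for
  all indices at once. It serves for powers, where the exponent drops by one, and for
  \<open>cog\<close> and \<open>sig\<close>, which are exchanged.\<close>

lemma smooth_on_of_derivative_family:
  fixes F :: "'i \<Rightarrow> real \<Rightarrow> real"
  assumes "open S"
    and "\<And>i x. x \<in> S \<Longrightarrow> (F i has_real_derivative c i * F (d i) x) (at x)"
  shows "smooth_on S (F i)"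
proof -
  have "Ck_on n S (F i)" for n
  proof (induction n arbitrary: i)
    case 0
    then show ?case
      by (auto intro!: continuous_at_imp_continuous_on DERIV_isCont assms(2))
  next
    case (Suc n)
    show ?case
    proof (rule Ck_on_SucI[OF assms(1)])
      show "(F i has_derivative (*) (c i * F (d i) x)) (at x)" if "x \<in> S" for x
        using assms(2)[OF that, of i] by (simp add: has_field_derivative_def)
      show "Ck_on n S (\<lambda>x. c i * F (d i) x * h)" for h
        by (intro bounded_bilinear.Ck_on[OF bounded_bilinear_mult] Ck_on_const assms(1) Suc.IH)
    qed
  qed
  then show ?thesis by (simp add: smooth_on_def)
qed

lemma smooth_on_powr: "smooth_on {0<..} (\<lambda>x::real. x powr a)"
  by (rule smooth_on_of_derivative_family[where F = "\<lambda>a x. x powr a" and d = "\<lambda>a. a - 1" and c = "\<lambda>a. a"])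
    (auto intro!: derivative_eq_intros simp: field_simps powr_diff)

text \<open>For \<open>\<tau> = \<plusminus>1\<close>, the solutions of \<open>y'' = \<tau> y\<close> that parametrize the conic \<open>x\<^sup>2 - \<tau> y\<^sup>2 = 1\<close>.\<close>

definition cog :: "real \<Rightarrow> real \<Rightarrow> real" where
  "cog \<tau> t = (if \<tau> = 1 then cosh t else cos t)"

definition sig :: "real \<Rightarrow> real \<Rightarrow> real" where
  "sig \<tau> t = (if \<tau> = 1 then sinh t else sin t)"

lemma cog_has_real_derivative:
  "\<tau> \<in> {-1, 1} \<Longrightarrow> (cog \<tau> has_real_derivative \<tau> * sig \<tau> t) (at t)"
  unfolding cog_def[abs_def] sig_def by (auto intro!: derivative_eq_intros)

lemma sig_has_real_derivative: "(sig \<tau> has_real_derivative cog \<tau> t) (at t)"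
  unfolding sig_def[abs_def] cog_def by (auto intro!: derivative_eq_intros)

lemma cog_sig: "\<tau> \<in> {-1, 1} \<Longrightarrow> (cog \<tau> t)\<^sup>2 - \<tau> * (sig \<tau> t)\<^sup>2 = 1"
  by (auto simp: cog_def sig_def hyperbolic_pythagoras)

lemma cog_sig_simps [simp]:
  "cog \<tau> 0 = 1" "sig \<tau> 0 = 0" "cog \<tau> (- t) = cog \<tau> t" "sig \<tau> (- t) = - sig \<tau> t"
  by (simp_all add: cog_def sig_def)

text \<open>The sign condition selects the branch of the hyperbola through (1, 0), on which
  \<open>arsinh y\<close> is the parameter; for \<open>\<tau> = -1\<close> the conic is the unit
  circle.\<close>

lemma cog_sig_surj:
  assumes "x\<^sup>2 - \<tau> * y\<^sup>2 = 1" "\<tau> \<in> {-1, 1}" "\<tau> = 1 \<Longrightarrow> 0 < x"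
  obtains t where "x = cog \<tau> t" "y = sig \<tau> t"
proof (cases "\<tau> = 1")
  case True
  have "cosh (arsinh y) = x"
    using assms True by (simp add: cosh_arsinh_real real_sqrt_unique algebra_simps)
  with True show ?thesis by (intro that[of "arsinh y"]) (simp_all add: cog_def sig_def)
next
  case False
  then obtain t where "x = cos t" "y = sin t"
    using assms by (auto elim: sincos_total_2pi)
  with False show ?thesis by (intro that[of t]) (simp_all add: cog_def sig_def)
qed

lemma smooth_on_cog_sig:
  assumes "\<tau> \<in> {-1, 1}"
  shows "smooth_on UNIV (cog \<tau>)" "smooth_on UNIV (sig \<tau>)"
proof -
  \<comment> \<open>With truth values as indices, differentiation negates the index.\<close>
  have "smooth_on UNIV (if b then cog \<tau> else sig \<tau>)" for b
    by (rule smooth_on_of_derivative_family[where F = "\<lambda>b. if b then cog \<tau> else sig \<tau>" and d = Not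
          and c = "\<lambda>b. if b then \<tau> else 1"])
      (auto intro: cog_has_real_derivative[OF assms] sig_has_real_derivative)
  from this[of True] this[of False] show "smooth_on UNIV (cog \<tau>)" "smooth_on UNIV (sig \<tau>)"
    by simp_all
qed

section \<open>Linear algebra of the Lorentzian product\<close>

lemma bounded_bilinear_lor: "bounded_bilinear lor"
  unfolding bilinear_conv_bounded_bilinear[symmetric] bilinear_def
  by (auto simp: lor_def algebra_simps intro!: linearI)

interpretation lor: bounded_bilinear lor
  by (rule bounded_bilinear_lor)

lemmas lor_linear = lor.add_left lor.add_right lor.diff_left lor.diff_right
  lor.scaleR_left lor.scaleR_right lor.minus_left lor.minus_right

lemma lor_commute: "lor u v = lor v u"
  by (simp add: lor_def)

text \<open>The Euclidean cross product with its last coordinate negated, so that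
  \<open>lor (lcross u v) w\<close> is the determinant of \<open>u\<close>, \<open>v\<close>,
  \<open>w\<close>.\<close>

definition lcross :: "real^3 \<Rightarrow> real^3 \<Rightarrow> real^3" where
  "lcross u v = vector
     [u$2 * v$3 - u$3 * v$2, u$3 * v$1 - u$1 * v$3, u$2 * v$1 - u$1 * v$2]"

lemma bounded_bilinear_lcross: "bounded_bilinear lcross"
  unfolding bilinear_conv_bounded_bilinear[symmetric] bilinear_def
  by (auto simp: lcross_def vec_eq_iff forall_3 algebra_simps intro!: linearI)

text \<open>The last equation is the Lagrange identity, with the sign opposite to the Euclidean
  one.\<close>

lemma lor_lcross:
  "lor (lcross u v) u = 0" "lor (lcross u v) v = 0" "lor u (lcross u v) = 0" "lor v (lcross u v) = 0"
  "lor (lcross u v) (lcross u v) = (lor u v)\<^sup>2 - lor u u * lor v v"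
  by (simp_all add: lor_def lcross_def algebra_simps power2_eq_square)

text \<open>Cramer's rule for \<open>T\<close>, \<open>v\<close>, \<open>lcross T v\<close> with the
  denominators cleared; in this form it is a polynomial identity in the coordinates.\<close>

lemma lor_lcross_expand:
  "lor (lcross T v) (lcross T v) *\<^sub>R u = lor u (lcross T v) *\<^sub>R lcross T v
     - (lor u T * lor v v - lor u v * lor T v) *\<^sub>R T - (lor u v * lor T T - lor u T * lor T v) *\<^sub>R v"
  by (simp add: vec_eq_iff forall_3 lor_def lcross_def) (intro conjI; algebra)

text \<open>For orthogonal \<open>T\<close> and \<open>v\<close> the square of
  \<open>lcross T v\<close> is \<open>- (lor T T * lor v v)\<close>, so the preceding identity can
  be divided by it.\<close>

lemma orthogonal_frame_expand:
  assumes "lor T T \<noteq> 0" "lor v v \<noteq> 0" "lor T v = 0"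
  shows "u = (lor u T / lor T T) *\<^sub>R T + (lor u v / lor v v) *\<^sub>R v
    + (lor u (lcross T v) / lor (lcross T v) (lcross T v)) *\<^sub>R lcross T v"
proof -
  let ?b = "lcross T v"
  have b: "lor ?b ?b = - (lor T T * lor v v)"
    using assms(3) by (simp add: lor_lcross)
  then have b0: "lor ?b ?b \<noteq> 0" using assms by simp
  have "u = (1 / lor ?b ?b) *\<^sub>R (lor ?b ?b *\<^sub>R u)" using b0 by simp
  also have "\<dots> = (lor u ?b / lor ?b ?b) *\<^sub>R ?b
      - (lor u T * lor v v / lor ?b ?b) *\<^sub>R T - (lor u v * lor T T / lor ?b ?b) *\<^sub>R v"
    unfolding lor_lcross_expand[of T v u] using assms(3) by (simp add: scaleR_diff_right)
  also have "lor u T * lor v v / lor ?b ?b = - (lor u T / lor T T)"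
    using assms b by (simp add: field_simps)
  also have "lor u v * lor T T / lor ?b ?b = - (lor u v / lor v v)"
    using assms b by (simp add: field_simps)
  finally show ?thesis by (simp add: algebra_simps)
qed

text \<open>The tangent plane is spanned by \<open>T\<close> and \<open>q\<close>, which are orthogonal.\<close>

lemma lor_Gram_det:
  assumes "lor T T \<noteq> 0" "lor v v \<noteq> 0" "lor T v = 0"
    and "lor p v = 0" "lor q v = 0" "lor q T = 0"
  shows "lor p p * lor q q - (lor p q)\<^sup>2 = (lor p T)\<^sup>2 / lor T T * lor q q"
proof -
  define b where "b = lcross T v"
  have b0: "lor b b \<noteq> 0" using assms(1-3) by (simp add: b_def lor_lcross)
  have bT: "lor T b = 0" "lor b T = 0" by (simp_all add: b_def lor_lcross)
  \<comment> \<open>Orthogonality to \<open>v\<close> removes the \<open>v\<close>-component of both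
    vectors, and orthogonality to \<open>T\<close> leaves \<open>q\<close> a multiple of
    \<open>b\<close>.\<close>
  obtain k l where p: "p = (lor p T / lor T T) *\<^sub>R T + k *\<^sub>R b" and q: "q = l *\<^sub>R b"
    using orthogonal_frame_expand[OF assms(1-3), of p] orthogonal_frame_expand[OF assms(1-3), of q] assms(4-6)
    unfolding b_def[symmetric] by auto
  define c where "c = lor p T / lor T T"
  have p: "p = c *\<^sub>R T + k *\<^sub>R b" using p by (simp add: c_def)
  have "lor p T = c * lor T T" using assms(1) by (simp add: c_def)
  moreover have "lor p p = c\<^sup>2 * lor T T + k\<^sup>2 * lor b b" "lor p q = k * l * lor b b" "lor q q = l\<^sup>2 * lor b b"
    unfolding p q by (simp_all add: lor_linear bT power2_eq_square algebra_simps)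
  ultimately show ?thesis using assms(1) by (simp add: power2_eq_square field_simps)
qed

text \<open>The vector \<open>q\<close> must be a multiple of \<open>lcross T v\<close>, whose
  square is non-zero.\<close>

lemma lor_self_ne_0:
  assumes "lor T T \<noteq> 0" "lor v v \<noteq> 0" "lor T v = 0" "lor q v = 0" "lor q T = 0" "q \<noteq> 0"
  shows "lor q q \<noteq> 0"
proof -
  have b0: "lor (lcross T v) (lcross T v) \<noteq> 0" using assms(1-3) by (simp add: lor_lcross)
  obtain l where q: "q = l *\<^sub>R lcross T v"
    using orthogonal_frame_expand[OF assms(1-3), of q] assms(4,5) by auto
  with assms(6) have "l \<noteq> 0" by auto
  with b0 show ?thesis by (simp add: q lor_linear)
qed

section \<open>Conics in the plane orthogonal to a unit vector\<close>

text \<open>The connected arc through \<open>r *\<^sub>R e\<close> of the conic of squared radius \<open>\<epsilon> r\<^sup>2\<close> in the plane orthogonal to \<open>T\<close>.\<close>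

definition conic_arc :: "real \<Rightarrow> real^3 \<Rightarrow> real^3 \<Rightarrow> real \<Rightarrow> real^3" where
  "conic_arc r T e t = r *\<^sub>R (cog (lor T T) t *\<^sub>R e + sig (lor T T) t *\<^sub>R lcross T e)"

lemma conic_arc_0 [simp]: "conic_arc r T e 0 = r *\<^sub>R e"
  by (simp add: conic_arc_def)

lemma conic_arc_has_vector_derivative:
  assumes "lor T T \<in> {-1, 1}"
  shows "(conic_arc r T e has_vector_derivative
    r *\<^sub>R ((lor T T * sig (lor T T) t) *\<^sub>R e + cog (lor T T) t *\<^sub>R lcross T e)) (at t)"
  unfolding conic_arc_def[abs_def]
  using cog_has_real_derivative[OF assms, of t] sig_has_real_derivative[of "lor T T" t]
  by (auto intro!: derivative_eq_intros simp: has_real_derivative_iff_has_vector_derivative)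

lemma continuous_on_conic_arc:
  "lor T T \<in> {-1, 1} \<Longrightarrow> continuous_on A (conic_arc r T e)"
  by (intro continuous_at_imp_continuous_on ballI
      has_vector_derivative_continuous[OF conic_arc_has_vector_derivative])

context
  fixes T e :: "real^3" and \<epsilon> :: real
  assumes T: "lor T T \<in> {-1, 1}" and \<epsilon>: "\<epsilon> \<in> {-1, 1}" and e: "lor e e = \<epsilon>" and Te: "lor T e = 0"
begin

lemma lor_conic_arc: "lor (conic_arc r T e t) T = 0" "lor (conic_arc r T e t) (conic_arc r T e t) = \<epsilon> * r\<^sup>2"
proof -
  have "lor e T = 0" using Te by (simp add: lor_commute)
  then show "lor (conic_arc r T e t) T = 0" by (simp add: conic_arc_def lor_linear lor_lcross)
  have "lor (conic_arc r T e t) (conic_arc r T e t)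
      = r\<^sup>2 * \<epsilon> * ((cog (lor T T) t)\<^sup>2 - lor T T * (sig (lor T T) t)\<^sup>2)"
    by (simp add: conic_arc_def lor_linear lor_lcross e Te power2_eq_square algebra_simps)
  then show "lor (conic_arc r T e t) (conic_arc r T e t) = \<epsilon> * r\<^sup>2"
    by (simp add: cog_sig[OF T])
qed

lemma lor_conic_arc_deriv:
  assumes "p = r *\<^sub>R ((lor T T * sig (lor T T) t) *\<^sub>R e + cog (lor T T) t *\<^sub>R lcross T e)"
  shows "lor p p = - (\<epsilon> * lor T T * r\<^sup>2)"
proof -
  have "lor T T * lor T T = 1" using T by auto
  then have "lor p p = - (\<epsilon> * lor T T * r\<^sup>2) * ((cog (lor T T) t)\<^sup>2 - lor T T * (sig (lor T T) t)\<^sup>2)"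
    unfolding assms
    by (simp add: lor_linear lor_lcross e Te power2_eq_square algebra_simps)
  then show ?thesis by (simp add: cog_sig[OF T])
qed

text \<open>Since \<open>lcross T e\<close> has square \<open>- (\<epsilon> * lor T T)\<close>, the
  section becomes the conic \<open>x\<^sup>2 - lor T T * y\<^sup>2 = r\<^sup>2\<close> in the basis
  \<open>e\<close>, \<open>lcross T e\<close>: a hyperbola for spacelike \<open>T\<close>, a circle
  for timelike \<open>T\<close>.\<close>

lemma section_coordinates:
  assumes "lor u T = 0" "lor u u = \<epsilon> * r\<^sup>2"
  obtains x y where "u = x *\<^sub>R e + y *\<^sub>R lcross T e" "x = \<epsilon> * lor u e" "x\<^sup>2 - lor T T * y\<^sup>2 = r\<^sup>2"
proof -
  let ?b = "lcross T e"
  define x y where "x = lor u e / lor e e" and "y = lor u ?b / lor ?b ?b"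
  have u: "u = x *\<^sub>R e + y *\<^sub>R ?b"
    using orthogonal_frame_expand[of T e u] T \<epsilon> e Te assms(1) unfolding x_def y_def by auto
  have "lor u u = \<epsilon> * (x\<^sup>2 - lor T T * y\<^sup>2)"
    unfolding u by (simp add: lor_linear lor_lcross e Te power2_eq_square algebra_simps)
  with assms(2) \<epsilon> have "x\<^sup>2 - lor T T * y\<^sup>2 = r\<^sup>2" by auto
  moreover have "x = \<epsilon> * lor u e" using e \<epsilon> by (auto simp: x_def)
  ultimately show ?thesis using u that by blast
qed

text \<open>For spacelike \<open>T\<close> the sign of \<open>\<epsilon> * lor u e\<close>, which is
  the coordinate of \<open>u\<close> along \<open>e\<close>, tells on which branch \<open>u\<close>
  lies.\<close>

lemma conic_arc_surj:
  assumes "lor u T = 0" "lor u u = \<epsilon> * r\<^sup>2" "0 < r" "lor T T = 1 \<Longrightarrow> 0 < \<epsilon> * lor u e"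
  shows "u \<in> range (conic_arc r T e)"
proof -
  obtain x y where u: "u = x *\<^sub>R e + y *\<^sub>R lcross T e" "x = \<epsilon> * lor u e" "x\<^sup>2 - lor T T * y\<^sup>2 = r\<^sup>2"
    using section_coordinates[OF assms(1,2)] .
  have "(x / r)\<^sup>2 - lor T T * (y / r)\<^sup>2 = 1"
    using u(3) assms(3) by (simp add: field_simps)
  moreover have "0 < x / r" if "lor T T = 1" using assms(3) assms(4)[OF that] u(2) by simp
  ultimately obtain t where "x / r = cog (lor T T) t" "y / r = sig (lor T T) t"
    using cog_sig_surj[OF _ T] by blast
  then have "u = conic_arc r T e t" using assms(3) u(1)
    by (simp add: conic_arc_def scaleR_add_right flip: \<open>x / r = _\<close> \<open>y / r = _\<close>)
  then show ?thesis by blast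
qed

text \<open>Here \<open>x\<^sup>2 = r\<^sup>2 + y\<^sup>2\<close> is positive: the line
  \<open>x = 0\<close> separates the two branches of the hyperbola.\<close>

lemma section_lor_ne_0:
  assumes "lor u T = 0" "lor u u = \<epsilon> * r\<^sup>2" "0 < r" "lor T T = 1"
  shows "lor u e \<noteq> 0"
proof -
  obtain x y where "x = \<epsilon> * lor u e" "x\<^sup>2 - lor T T * y\<^sup>2 = r\<^sup>2"
    using section_coordinates[OF assms(1,2)] .
  moreover have "0 < r\<^sup>2" using assms(3) by simp
  moreover have "0 \<le> y\<^sup>2" by simp
  ultimately show ?thesis using assms(4) by (metis add.commute add_nonneg_pos diff_add_cancel less_irrefl mult_1 mult_zero_right power_zero_numeral)
qed

text \<open>The range is a connected set of reals, so if it were finite it would be a single point.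
  A function that is constant along the arc forces both normal components of \<open>a\<close> to
  vanish.\<close>

lemma infinite_lor_conic_arc:
  assumes "lor a T = 0" "a \<noteq> 0" "0 < r"
  shows "infinite (range (\<lambda>t. lor a (conic_arc r T e t)))"
proof
  let ?f = "\<lambda>t. lor a (conic_arc r T e t)"
  let ?c = "cog (lor T T)" and ?s = "sig (lor T T)"
  define A B where "A = lor a e" and "B = lor a (lcross T e)"
  have f: "?f t = r * (?c t * A + ?s t * B)" for t
    by (simp add: conic_arc_def lor_linear A_def B_def)
  assume fin: "finite (range ?f)"
  have "connected (range ?f)"
    by (intro connected_continuous_image lor.continuous_on continuous_on_const continuous_on_conic_arc T connected_UNIV)
  with fin obtain k where "range ?f = {k}"
    using connected_finite_iff_sing by (metis UNIV_not_empty image_is_empty)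
  then have "?f t = ?f 0" for t by (metis rangeI singletonD)
  then have eq: "?c t * A + ?s t * B = A" for t
    using assms(3) f[of t] f[of 0] by simp
  \<comment> \<open>\<open>cog\<close> is even and \<open>sig\<close> is odd, so the values at 1 and
    -1 separate \<open>B\<close> from \<open>A\<close>.\<close>
  have "?c 1 * A - ?s 1 * B = A" using eq[of "-1"] by simp
  with eq[of 1] have "?s 1 * B = 0" by linarith
  moreover have "?s 1 \<noteq> 0" using T sin_gt_zero[of 1] pi_gt3 by (auto simp: sig_def)
  ultimately have "B = 0" by simp
  moreover have "?c 1 \<noteq> 1"
    using T cos_inj_pi[of 1 0] pi_gt3 cosh_real_strict_mono[of 0 1] by (auto simp: cog_def)
  ultimately have "A = 0" using eq[of 1] by simp
  have "a = 0"
    using orthogonal_frame_expand[of T e a] T \<epsilon> e Te assms(1) \<open>A = 0\<close> \<open>B = 0\<close> unfolding A_def B_def by auto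
  with assms(2) show False ..
qed

end

section \<open>Curvatures of tubular surfaces\<close>

lemma has_vector_derivative_slices:
  fixes \<psi> :: "real \<times> real \<Rightarrow> 'b::real_normed_vector"
  assumes "(\<psi> has_derivative D) (at z)"
  shows "((\<lambda>s. \<psi> (s, snd z)) has_vector_derivative D (1, 0)) (at (fst z))"
    and "((\<lambda>t. \<psi> (fst z, t)) has_vector_derivative D (0, 1)) (at (snd z))"
proof -
  have 1: "((\<lambda>s. (s, snd z)) has_vector_derivative (1, 0)) (at (fst z))"
    and 2: "((\<lambda>t. (fst z, t)) has_vector_derivative (0, 1)) (at (snd z))"
    by (auto intro!: has_vector_derivative_Pair has_vector_derivative_const has_vector_derivative_id simp: has_vector_derivative_const)
  have "(\<psi> has_derivative D) (at (fst z, snd z) within R)" for R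
    using assms by (simp add: has_derivative_at_withinI)
  with vector_derivative_diff_chain_within[OF 1, of \<psi> D]
    vector_derivative_diff_chain_within[OF 2, of \<psi> D]
  show "((\<lambda>s. \<psi> (s, snd z)) has_vector_derivative D (1, 0)) (at (fst z))"
    and "((\<lambda>t. \<psi> (fst z, t)) has_vector_derivative D (0, 1)) (at (snd z))"
    by (simp_all add: o_def)
qed

lemma
  assumes "smooth_on V \<psi>" "z \<in> V"
  shows pd1_eq: "pd1 \<psi> z = frechet_derivative \<psi> (at z) (1, 0)"
    and pd2_eq: "pd2 \<psi> z = frechet_derivative \<psi> (at z) (0, 1)"
    and has_vector_derivative_pd1: "((\<lambda>s. \<psi> (s, snd z)) has_vector_derivative pd1 \<psi> z) (at (fst z))"
    and has_vector_derivative_pd2: "((\<lambda>t. \<psi> (fst z, t)) has_vector_derivative pd2 \<psi> z) (at (snd z))"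
proof -
  note sl = has_vector_derivative_slices[OF smooth_on_has_derivative[OF assms]]
  show "pd1 \<psi> z = frechet_derivative \<psi> (at z) (1, 0)" "pd2 \<psi> z = frechet_derivative \<psi> (at z) (0, 1)"
    using sl by (simp_all add: pd1_def pd2_def vector_derivative_at)
  with sl show "((\<lambda>s. \<psi> (s, snd z)) has_vector_derivative pd1 \<psi> z) (at (fst z))"
    "((\<lambda>t. \<psi> (fst z, t)) has_vector_derivative pd2 \<psi> z) (at (snd z))"
    by simp_all
qed

lemma smooth_on_pd:
  assumes "open V" "smooth_on V \<psi>"
  shows "smooth_on V (pd1 \<psi>)" "smooth_on V (pd2 \<psi>)"
  using smooth_on_frechet_derivative[OF assms(2)] pd1_eq[OF assms(2)] pd2_eq[OF assms(2)]
  by (simp_all cong: smooth_on_cong[OF assms(1)])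

lemma frechet_derivative_eq_pd:
  assumes "smooth_on V \<psi>" "z \<in> V"
  shows "frechet_derivative \<psi> (at z) h = fst h *\<^sub>R pd1 \<psi> z + snd h *\<^sub>R pd2 \<psi> z"
proof -
  interpret linear "frechet_derivative \<psi> (at z)"
    by (rule has_derivative_linear[OF smooth_on_has_derivative[OF assms]])
  have "h = fst h *\<^sub>R (1, 0) + snd h *\<^sub>R (0, 1)" by (simp add: prod_eq_iff)
  then show ?thesis unfolding pd1_eq[OF assms] pd2_eq[OF assms] by (metis add scale)
qed

text \<open>An identity that holds on the open set \<open>V\<close> holds near \<open>z\<close> on
  both coordinate lines, so it may be differentiated there.\<close>

lemma slice_derivative_0:
  fixes h :: "real \<times> real \<Rightarrow> real"
  assumes "open V" "z \<in> V" "\<And>y. y \<in> V \<Longrightarrow> h y = c"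
  shows "((\<lambda>s. h (s, snd z)) has_vector_derivative d) (at (fst z)) \<Longrightarrow> d = 0"
    and "((\<lambda>t. h (fst z, t)) has_vector_derivative d) (at (snd z)) \<Longrightarrow> d = 0"
proof -
  have "open ((\<lambda>s. (s, snd z)) -` V)" "open ((\<lambda>t. (fst z, t)) -` V)"
    by (intro open_vimage assms(1) continuous_intros)+
  note op = this
  have z: "fst z \<in> (\<lambda>s. (s, snd z)) -` V" "snd z \<in> (\<lambda>t. (fst z, t)) -` V"
    using assms(2) by simp_all
  show "d = 0" if "((\<lambda>s. h (s, snd z)) has_vector_derivative d) (at (fst z))"
  proof -
    have "((\<lambda>s. c) has_vector_derivative d) (at (fst z))"
      by (rule has_vector_derivative_transform_within_open[OF that op(1) z(1)]) (use assms(3) in auto)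
    then show ?thesis using vector_derivative_unique_at has_vector_derivative_const by blast
  qed
  show "d = 0" if "((\<lambda>t. h (fst z, t)) has_vector_derivative d) (at (snd z))"
  proof -
    have "((\<lambda>t. c) has_vector_derivative d) (at (snd z))"
      by (rule has_vector_derivative_transform_within_open[OF that op(2) z(2)]) (use assms(3) in auto)
    then show ?thesis using vector_derivative_unique_at has_vector_derivative_const by blast
  qed
qed

section \<open>The central curve and the normal sections\<close>

definition causal :: "tube \<Rightarrow> real \<Rightarrow> real" where
  "causal S s = lor (tangent S s) (tangent S s)"

text \<open>The component of \<open>\<psi>\<^sub>s\<close> along \<open>\<gamma>'\<close>; both curvatures depend on the point only through it.\<close>

definition speed :: "tube \<Rightarrow> real \<times> (real^3) \<Rightarrow> real" where
  "speed S p = 1 - causal S (fst p) * lor (accel S (fst p)) (snd p)"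

lemma open_dom_of: "open (dom_of S)"
  by (simp add: dom_of_def)

lemma tubular_surfaceD:
  assumes "tubular_surface S"
  shows "smooth_on (dom_of S) (curve S)" "0 < radius S" "signal S \<in> {-1, 1}"
    and "\<And>s. s \<in> dom_of S \<Longrightarrow> causal S s \<in> {-1, 1}"
    and "\<And>s. s \<in> dom_of S \<Longrightarrow> signal S = -1 \<Longrightarrow> causal S s = 1"
    and "\<And>s v. (s, v) \<in> pairs S \<Longrightarrow> s \<in> dom_of S"
    and "\<And>s v. (s, v) \<in> pairs S \<Longrightarrow> lor v (tangent S s) = 0"
    and "\<And>s v. (s, v) \<in> pairs S \<Longrightarrow> lor v v = signal S * (radius S)\<^sup>2"
proof -
  show "smooth_on (dom_of S) (curve S)" "0 < radius S" "signal S \<in> {-1, 1}"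
    using assms unfolding tubular_surface_def by blast+
  show "causal S s \<in> {-1, 1}" if "s \<in> dom_of S" for s
    using assms that unfolding tubular_surface_def spacelike_curve_def timelike_curve_def causal_def
    by blast
  show "causal S s = 1" if "s \<in> dom_of S" "signal S = -1" for s
    using assms that unfolding tubular_surface_def spacelike_curve_def causal_def by blast
  have "pairs S \<subseteq> (SIGMA s:dom_of S. normal_section S s)"
  proof -
    consider "pairs S = (SIGMA s:dom_of S. normal_section S s)"
      | \<sigma> where "pairs S = (SIGMA s:dom_of S. connected_component_set (normal_section S s) (\<sigma> s))"
      using assms unfolding tubular_surface_def by blast
    then show ?thesis by cases (auto dest: connected_component_in)
  qed
  then show "s \<in> dom_of S" "lor v (tangent S s) = 0" "lor v v = signal S * (radius S)\<^sup>2"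
    if "(s, v) \<in> pairs S" for s v
    using that by (auto simp: normal_section_def)
qed

text \<open>The last claim comes from differentiating the constant \<open>lor T T\<close> of the
  tangent \<open>T\<close>.\<close>

lemma tubular_surface_smooth:
  assumes "tubular_surface S"
  shows "smooth_on (dom_of S) (tangent S)"
    and "\<And>s. s \<in> dom_of S \<Longrightarrow> (curve S has_vector_derivative tangent S s) (at s)"
    and "\<And>s. s \<in> dom_of S \<Longrightarrow> (tangent S has_vector_derivative accel S s) (at s)"
    and "\<And>s. s \<in> dom_of S \<Longrightarrow> lor (accel S s) (tangent S s) = 0"
proof -
  note sm = tubular_surfaceD(1)[OF assms]
  show smT: "smooth_on (dom_of S) (tangent S)"
    unfolding tangent_def by (intro smooth_on_vderiv open_dom_of sm)
  show "(curve S has_vector_derivative tangent S s) (at s)" if "s \<in> dom_of S" for s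
    unfolding tangent_def using sm that by (rule smooth_on_has_vector_derivative)
  show T': "(tangent S has_vector_derivative accel S s) (at s)" if "s \<in> dom_of S" for s
    using smooth_on_has_vector_derivative[OF smT that] by (simp add: accel_def tangent_def)
  show "lor (accel S s) (tangent S s) = 0" if s: "s \<in> dom_of S" for s
  proof -
    obtain c where c: "\<And>x. x \<in> dom_of S \<Longrightarrow> lor (tangent S x) (tangent S x) = c"
      using assms unfolding tubular_surface_def spacelike_curve_def timelike_curve_def by blast
    have "((\<lambda>x. lor (tangent S x) (tangent S x)) has_vector_derivative
        lor (tangent S s) (accel S s) + lor (accel S s) (tangent S s)) (at s)"
      by (intro lor.has_vector_derivative T' s)
    then have "((\<lambda>x. c) has_vector_derivative
        lor (tangent S s) (accel S s) + lor (accel S s) (tangent S s)) (at s)"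
      by (rule has_vector_derivative_transform_within_open[OF _ open_dom_of s]) (use c in auto)
    then have "lor (tangent S s) (accel S s) + lor (accel S s) (tangent S s) = 0"
      using vector_derivative_unique_at has_vector_derivative_const by blast
    then show ?thesis by (simp add: lor_commute)
  qed
qed

lemma speed_ne_0: "regular_tubular S \<Longrightarrow> p \<in> pairs S \<Longrightarrow> speed S p \<noteq> 0"
  by (auto simp: regular_tubular_def speed_def causal_def)

text \<open>This is \<open>local_param\<close> with injectivity of the derivative left out. The
  identities for both fundamental forms hold at this level, and they then reduce injectivity to
  \<open>pd2 \<psi> z \<noteq> 0\<close>.\<close>

definition lifts :: "tube \<Rightarrow> (real \<times> real) set \<Rightarrow> (real \<times> real \<Rightarrow> real^3) \<Rightarrow> bool" where
  "lifts S V \<psi> \<longleftrightarrow> open V \<and> smooth_on V \<psi> \<and> (\<forall>z\<in>V. (fst z, \<psi> z - curve S (fst z)) \<in> pairs S)"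

context
  fixes S V \<psi>
  assumes S: "tubular_surface S" and lifts: "lifts S V \<psi>"
begin

private abbreviation "N z \<equiv> \<psi> z - curve S (fst z)"
private abbreviation "T z \<equiv> tangent S (fst z)"
private abbreviation "A z \<equiv> accel S (fst z)"

private lemma V: "open V" "smooth_on V \<psi>" and in_pairs: "z \<in> V \<Longrightarrow> (fst z, N z) \<in> pairs S"
  using lifts by (auto simp: lifts_def)

private lemma in_dom: "z \<in> V \<Longrightarrow> fst z \<in> dom_of S"
  using tubular_surfaceD(6)[OF S in_pairs] .

private lemma NT: "z \<in> V \<Longrightarrow> lor (N z) (T z) = 0"
  and NN: "z \<in> V \<Longrightarrow> lor (N z) (N z) = signal S * (radius S)\<^sup>2"
  using tubular_surfaceD(7,8)[OF S in_pairs] by simp_all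

private lemma N_deriv:
  assumes "z \<in> V"
  shows "((\<lambda>s. N (s, snd z)) has_vector_derivative pd1 \<psi> z - T z) (at (fst z))"
    and "((\<lambda>t. N (fst z, t)) has_vector_derivative pd2 \<psi> z) (at (snd z))"
  using has_vector_derivative_diff[OF has_vector_derivative_pd1[OF V(2) assms]
      tubular_surface_smooth(2)[OF S in_dom[OF assms]]]
    has_vector_derivative_diff[OF has_vector_derivative_pd2[OF V(2) assms] has_vector_derivative_const]
  by simp_all

text \<open>Differentiate \<open>lor N N = signal S * (radius S)\<^sup>2\<close> and
  \<open>lor N T = 0\<close> in both variables. The tangent \<open>T\<close> varies with
  \<open>s\<close> only, and this is how the acceleration enters the last equation.\<close>

lemma lor_pd:
  assumes z: "z \<in> V"
  shows "lor (pd1 \<psi> z) (N z) = 0" "lor (pd2 \<psi> z) (N z) = 0" "lor (pd2 \<psi> z) (T z) = 0"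
    and "lor (pd1 \<psi> z) (T z) = causal S (fst z) * speed S (fst z, N z)"
proof -
  note dN = N_deriv[OF z] and T' = tubular_surface_smooth(3)[OF S in_dom[OF z]]
  note const = slice_derivative_0[OF V(1) z]
  have "lor (N z) (pd1 \<psi> z - T z) + lor (pd1 \<psi> z - T z) (N z) = 0"
    using NN lor.has_vector_derivative[OF dN(1) dN(1)]
    by (intro const(1)[where h = "\<lambda>z. lor (N z) (N z)"]) simp_all
  then show "lor (pd1 \<psi> z) (N z) = 0"
    using NT[OF z] by (simp add: lor_linear lor_commute)
  have "lor (N z) (pd2 \<psi> z) + lor (pd2 \<psi> z) (N z) = 0"
    using NN lor.has_vector_derivative[OF dN(2) dN(2)]
    by (intro const(2)[where h = "\<lambda>z. lor (N z) (N z)"]) simp_all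
  then show "lor (pd2 \<psi> z) (N z) = 0"
    by (simp add: lor_commute)
  have "lor (N z) 0 + lor (pd2 \<psi> z) (T z) = 0"
    using NT lor.has_vector_derivative[OF dN(2) has_vector_derivative_const]
    by (intro const(2)[where h = "\<lambda>z. lor (N z) (T z)"]) simp_all
  then show "lor (pd2 \<psi> z) (T z) = 0" by (simp add: lor.zero_right)
  have "lor (N z) (A z) + lor (pd1 \<psi> z - T z) (T z) = 0"
    using NT lor.has_vector_derivative[OF dN(1) T']
    by (intro const(1)[where h = "\<lambda>z. lor (N z) (T z)"]) simp_all
  then have "lor (pd1 \<psi> z) (T z) = causal S (fst z) - lor (A z) (N z)"
    unfolding lor.diff_left[of "pd1 \<psi> z"] lor_commute[of "N z" "A z"] causal_def by linarith
  then show "lor (pd1 \<psi> z) (T z) = causal S (fst z) * speed S (fst z, N z)"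
    using tubular_surfaceD(4)[OF S in_dom[OF z]] by (auto simp: speed_def)
qed

text \<open>Differentiating the orthogonality of \<open>pd1 \<psi>\<close> and
  \<open>pd2 \<psi>\<close> to \<open>N\<close> expresses the second form by the first one. Here
  \<open>N\<close> is the radial vector, which is \<open>- radius S\<close> times the unit
  normal.\<close>

lemma lor_pd_pd:
  assumes z: "z \<in> V"
  shows "lor (pd1 (pd1 \<psi>) z) (N z) = - (ff_E \<psi> z - causal S (fst z) * speed S (fst z, N z))"
    and "lor (pd2 (pd1 \<psi>) z) (N z) = - ff_F \<psi> z"
    and "lor (pd2 (pd2 \<psi>) z) (N z) = - ff_G \<psi> z"
proof -
  note dN = N_deriv[OF z]
  note const = slice_derivative_0[OF V(1) z]
  note sm = smooth_on_pd[OF V]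
  have "lor (pd1 \<psi> z) (pd1 \<psi> z - T z) + lor (pd1 (pd1 \<psi>) z) (N z) = 0"
    using lor_pd(1) lor.has_vector_derivative[OF has_vector_derivative_pd1[OF sm(1) z] dN(1)]
    by (intro const(1)[where h = "\<lambda>z. lor (pd1 \<psi> z) (N z)"]) simp_all
  then show "lor (pd1 (pd1 \<psi>) z) (N z) = - (ff_E \<psi> z - causal S (fst z) * speed S (fst z, N z))"
    using lor_pd(4)[OF z] by (simp add: lor.diff_right ff_E_def)
  have "lor (pd1 \<psi> z) (pd2 \<psi> z) + lor (pd2 (pd1 \<psi>) z) (N z) = 0"
    using lor_pd(1) lor.has_vector_derivative[OF has_vector_derivative_pd2[OF sm(1) z] dN(2)]
    by (intro const(2)[where h = "\<lambda>z. lor (pd1 \<psi> z) (N z)"]) simp_all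
  then show "lor (pd2 (pd1 \<psi>) z) (N z) = - ff_F \<psi> z"
    by (simp add: ff_F_def)
  have "lor (pd2 \<psi> z) (pd2 \<psi> z) + lor (pd2 (pd2 \<psi>) z) (N z) = 0"
    using lor_pd(2) lor.has_vector_derivative[OF has_vector_derivative_pd2[OF sm(2) z] dN(2)]
    by (intro const(2)[where h = "\<lambda>z. lor (pd2 \<psi> z) (N z)"]) simp_all
  then show "lor (pd2 (pd2 \<psi>) z) (N z) = - ff_G \<psi> z"
    by (simp add: ff_G_def)
qed

text \<open>The Gram determinant formula with \<open>p = pd1 \<psi> z\<close> and
  \<open>q = pd2 \<psi> z\<close>; dividing by \<open>causal\<close>, which is 1 or -1, is
  multiplying by it.\<close>

lemma first_form:
  assumes z: "z \<in> V"
  shows "ff_E \<psi> z * ff_G \<psi> z - (ff_F \<psi> z)\<^sup>2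
      = causal S (fst z) * (speed S (fst z, N z))\<^sup>2 * ff_G \<psi> z"
    and "pd2 \<psi> z \<noteq> 0 \<Longrightarrow> ff_G \<psi> z \<noteq> 0"
proof -
  have c: "causal S (fst z) \<in> {-1, 1}" by (rule tubular_surfaceD(4)[OF S in_dom[OF z]])
  have T0: "lor (T z) (T z) \<noteq> 0" using c by (auto simp: causal_def)
  have N0: "lor (N z) (N z) \<noteq> 0" using NN[OF z] tubular_surfaceD(2,3)[OF S] by auto
  have TN: "lor (T z) (N z) = 0" using NT[OF z] by (simp add: lor_commute)
  show "pd2 \<psi> z \<noteq> 0 \<Longrightarrow> ff_G \<psi> z \<noteq> 0"
    unfolding ff_G_def using lor_self_ne_0[OF T0 N0 TN lor_pd(2,3)[OF z]] .
  show "ff_E \<psi> z * ff_G \<psi> z - (ff_F \<psi> z)\<^sup>2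
      = causal S (fst z) * (speed S (fst z, N z))\<^sup>2 * ff_G \<psi> z"
    using lor_Gram_det[OF T0 N0 TN lor_pd(1,2,3)[OF z]] c
    unfolding ff_E_def ff_F_def ff_G_def lor_pd(4)[OF z] causal_def[symmetric] by auto
qed

end

text \<open>By regularity \<open>pd1 \<psi> z\<close> has a non-zero product with the tangent, while
  \<open>pd2 \<psi> z\<close> is orthogonal to it. Hence the two are independent as soon as the
  second is non-zero.\<close>

lemma local_param_iff:
  assumes "regular_tubular S"
  shows "local_param S V \<psi> \<longleftrightarrow> lifts S V \<psi> \<and> (\<forall>z\<in>V. pd2 \<psi> z \<noteq> 0)"
proof -
  have S: "tubular_surface S" using assms by (simp add: regular_tubular_def)
  have "inj (frechet_derivative \<psi> (at z)) \<longleftrightarrow> pd2 \<psi> z \<noteq> 0" if L: "lifts S V \<psi>" and z: "z \<in> V" for z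
  proof -
    have sm: "smooth_on V \<psi>" and p: "(fst z, \<psi> z - curve S (fst z)) \<in> pairs S"
      using L z by (auto simp: lifts_def)
    note D = frechet_derivative_eq_pd[OF sm z]
    have lin: "linear (frechet_derivative \<psi> (at z))"
      by (rule has_derivative_linear[OF smooth_on_has_derivative[OF sm z]])
    have w: "lor (pd1 \<psi> z) (tangent S (fst z)) \<noteq> 0"
      using lor_pd(4)[OF S L z] speed_ne_0[OF assms p] tubular_surfaceD(4)[OF S tubular_surfaceD(6)[OF S p]]
      by auto
    show ?thesis unfolding linear_injective_0[OF lin]
    proof safe
      assume "\<forall>h. frechet_derivative \<psi> (at z) h = 0 \<longrightarrow> h = 0" "pd2 \<psi> z = 0"
      moreover have "frechet_derivative \<psi> (at z) (0, 1) = 0"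
        using \<open>pd2 \<psi> z = 0\<close> by (simp add: D)
      ultimately have "(0::real, 1::real) = 0" by blast
      then show False by (simp add: zero_prod_def)
    next
      fix h1 h2 assume q: "pd2 \<psi> z \<noteq> 0" and h: "frechet_derivative \<psi> (at z) (h1, h2) = 0"
      have "h1 * lor (pd1 \<psi> z) (tangent S (fst z)) = 0"
        using arg_cong[OF h, of "\<lambda>x. lor x (tangent S (fst z))"] lor_pd(3)[OF S L z]
        unfolding D by (simp add: lor_linear lor.zero_left)
      with w have "h1 = 0" by simp
      with h q D[of "(h1, h2)"] show "(h1, h2) = 0" by (simp add: zero_prod_def)
    qed
  qed
  then show ?thesis unfolding local_param_def lifts_def by blast
qed

text \<open>\<open>E\<close>, \<open>F\<close> and \<open>G\<close> enter the numerators only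
  through \<open>E * G - F\<^sup>2\<close> and a multiple of \<open>G\<close>, so the quotients
  retain nothing of the parametrization but \<open>w\<close>.\<close>

lemma curvature_in:
  assumes R: "regular_tubular S" and L: "local_param S V \<psi>" and z: "z \<in> V"
  defines "w \<equiv> speed S (fst z, \<psi> z - curve S (fst z))"
  shows "w \<noteq> 0" "ff_E \<psi> z * ff_G \<psi> z - (ff_F \<psi> z)\<^sup>2 \<noteq> 0"
    and "gauss_in S \<psi> z = signal S * (1 - 1 / w) / (radius S)\<^sup>2"
    and "mean_in S \<psi> z = signal S * (2 - 1 / w) / (2 * radius S)"
proof -
  let ?\<tau> = "causal S (fst z)" and ?r = "radius S"
  have S: "tubular_surface S" using R by (simp add: regular_tubular_def)
  have lf: "lifts S V \<psi>" and q: "pd2 \<psi> z \<noteq> 0"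
    using local_param_iff[OF R] L z by auto
  have p: "(fst z, \<psi> z - curve S (fst z)) \<in> pairs S" using lf z by (auto simp: lifts_def)
  then have \<tau>: "?\<tau> \<in> {-1, 1}" by (intro tubular_surfaceD(4)[OF S] tubular_surfaceD(6)[OF S])
  show w0: "w \<noteq> 0" unfolding w_def by (rule speed_ne_0[OF R p])
  define E F G where "E = ff_E \<psi> z" and "F = ff_F \<psi> z" and "G = ff_G \<psi> z"
  have G0: "G \<noteq> 0" using first_form(2)[OF S lf z q] by (simp add: G_def)
  have D: "E * G - F\<^sup>2 = ?\<tau> * w\<^sup>2 * G"
    using first_form(1)[OF S lf z] by (simp add: E_def F_def G_def w_def)
  then show "ff_E \<psi> z * ff_G \<psi> z - (ff_F \<psi> z)\<^sup>2 \<noteq> 0"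
    using w0 G0 \<tau> by (auto simp: E_def F_def G_def)
  have r: "?r \<noteq> 0" using tubular_surfaceD(2)[OF S] by simp
  \<comment> \<open>The minus sign of the unit normal cancels those in the formulas for the second
    derivatives.\<close>
  have normal: "lor u (unit_normal S \<psi> z) = - lor u (\<psi> z - curve S (fst z)) / ?r" for u
    by (simp add: unit_normal_def lor.scaleR_right lor.minus_right divide_inverse_commute)
  have sf: "sf_e S \<psi> z = (E - ?\<tau> * w) / ?r" "sf_f S \<psi> z = F / ?r" "sf_g S \<psi> z = G / ?r"
    unfolding sf_e_def sf_f_def sf_g_def normal E_def F_def G_def w_def
    by (simp_all add: lor_pd_pd[OF S lf z])
  \<comment> \<open>The common denominator; the remaining term \<open>?\<tau> * w * G\<close> is
    \<open>c / w\<close>, so \<open>c\<close> cancels from both curvatures.\<close>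
  define c where "c = ?\<tau> * w\<^sup>2 * G"
  have c0: "c \<noteq> 0" using w0 G0 \<tau> by (auto simp: c_def)
  have D: "E * G - F\<^sup>2 = c" using D by (simp add: c_def)
  have cw: "?\<tau> * w * G = c / w" using w0 by (simp add: c_def power2_eq_square)
  have "sf_e S \<psi> z * sf_g S \<psi> z - (sf_f S \<psi> z)\<^sup>2 = (E * G - F\<^sup>2 - ?\<tau> * w * G) / ?r\<^sup>2"
    unfolding sf using r by (simp add: field_simps power2_eq_square)
  also have "\<dots> = c * (1 - 1 / w) / ?r\<^sup>2"
    unfolding D cw by (simp add: right_diff_distrib)
  finally show "gauss_in S \<psi> z = signal S * (1 - 1 / w) / ?r\<^sup>2"
    using c0 unfolding gauss_in_def E_def[symmetric] F_def[symmetric] G_def[symmetric] D by simp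
  have "sf_e S \<psi> z * G - 2 * sf_f S \<psi> z * F + sf_g S \<psi> z * E = (2 * (E * G - F\<^sup>2) - ?\<tau> * w * G) / ?r"
    unfolding sf using r by (simp add: field_simps power2_eq_square)
  also have "\<dots> = c * (2 - 1 / w) / ?r"
    unfolding D cw by (simp add: right_diff_distrib)
  finally show "mean_in S \<psi> z = signal S * (2 - 1 / w) / (2 * ?r)"
    using c0 unfolding mean_in_def E_def[symmetric] F_def[symmetric] G_def[symmetric] D by simp
qed

section \<open>Existence of local parametrizations\<close>

text \<open>A normal vector whose square has the sign of the signal is given explicitly for each
  causal type and then rescaled.\<close>

lemma pairs_nonempty:
  assumes S: "tubular_surface S" and s: "s \<in> dom_of S"
  shows "\<exists>v. (s, v) \<in> pairs S"
proof -
  let ?T = "tangent S s" and ?\<epsilon> = "signal S" and ?r = "radius S"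
  define \<rho> where "\<rho> = (?T$1)\<^sup>2 + (?T$2)\<^sup>2"
  have T: "\<rho> - (?T$3)\<^sup>2 = causal S s"
    by (simp add: \<rho>_def causal_def lor_def power2_eq_square)
  have c: "causal S s \<in> {-1, 1}" "?\<epsilon> = -1 \<Longrightarrow> causal S s = 1" "?\<epsilon> \<in> {-1, 1}"
    using tubular_surfaceD(3,4,5)[OF S] s by auto
  have "\<exists>u. lor u ?T = 0 \<and> 0 < ?\<epsilon> * lor u u"
  proof -
    consider "causal S s = 1" "?\<epsilon> = 1" | "causal S s = -1" "?\<epsilon> = 1" | "causal S s = 1" "?\<epsilon> = -1"
      using c by auto
    then show ?thesis
    proof cases
      case 1
      \<comment> \<open>The horizontal part of a spacelike tangent is non-zero; turned by a right
        angle it is a spacelike normal vector.\<close>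
      have "0 < \<rho>" using T 1 zero_le_power2[of "?T$3"] by linarith
      then have "lor (vector [?T$2, - ?T$1, 0]) ?T = 0 \<and>
          0 < ?\<epsilon> * lor (vector [?T$2, - ?T$1, 0]) (vector [?T$2, - ?T$1, 0])"
        using 1 by (simp add: lor_def \<rho>_def power2_eq_square add.commute)
      then show ?thesis by blast
    next
      case 2
      \<comment> \<open>For a timelike tangent this difference is
        \<open>1 + (?T$2)\<^sup>2\<close>.\<close>
      have "0 < (?T$3)\<^sup>2 - (?T$1)\<^sup>2"
        using T 2 zero_le_power2[of "?T$2"] unfolding \<rho>_def by linarith
      then have "lor (vector [?T$3, 0, ?T$1]) ?T = 0 \<and>
          0 < ?\<epsilon> * lor (vector [?T$3, 0, ?T$1]) (vector [?T$3, 0, ?T$1])"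
        using 2 by (simp add: lor_def power2_eq_square)
      then show ?thesis by blast
    next
      case 3
      \<comment> \<open>As \<open>\<rho> = 1 + (?T$3)\<^sup>2\<close>, this is the projection of the
        third basis vector to the normal plane, which is timelike.\<close>
      let ?u = "vector [?T$1 * ?T$3, ?T$2 * ?T$3, \<rho>] :: real^3"
      have \<rho>: "0 < \<rho>" "\<rho> - (?T$3)\<^sup>2 = 1" using T 3 zero_le_power2[of "?T$3"] by linarith+
      have "lor ?u ?T = 0"
        by (simp add: lor_def \<rho>_def power2_eq_square algebra_simps)
      moreover have "lor ?u ?u = \<rho> * (?T$3)\<^sup>2 - \<rho>\<^sup>2"
        by (simp add: lor_def \<rho>_def power2_eq_square algebra_simps)
      then have "?\<epsilon> * lor ?u ?u = \<rho> * (\<rho> - (?T$3)\<^sup>2)"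
        using 3 by (simp add: power2_eq_square algebra_simps)
      ultimately show ?thesis using \<rho> by (intro exI[of _ ?u]) simp
    qed
  qed
  then obtain u where u: "lor u ?T = 0" "0 < ?\<epsilon> * lor u u" by blast
  define m where "m = ?\<epsilon> * lor u u"
  define k where "k = ?r / sqrt m"
  have "0 < m" using u(2) by (simp add: m_def)
  then have "k\<^sup>2 * m = ?r\<^sup>2" by (simp add: k_def power_divide)
  moreover have "lor u u = ?\<epsilon> * m" using c(3) by (auto simp: m_def)
  ultimately have "k\<^sup>2 * lor u u = ?\<epsilon> * ?r\<^sup>2" by (metis mult.left_commute)
  then have "k *\<^sub>R u \<in> normal_section S s"
    using u(1) by (simp add: normal_section_def lor_linear power2_eq_square mult.assoc)
  \<comment> \<open>The rescaled vector serves for full sections; if a branch is chosen,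
    \<open>\<sigma> s\<close> itself lies in it.\<close>
  with S s show ?thesis
    unfolding tubular_surface_def by (auto intro: connected_component_refl)
qed

section \<open>Branches of the normal sections and frames along the curve\<close>

lemma causal_const:
  assumes "tubular_surface S"
  obtains \<tau> where "\<tau> \<in> {-1, 1}" "\<And>s. s \<in> dom_of S \<Longrightarrow> lor (tangent S s) (tangent S s) = \<tau>"
  using assms unfolding tubular_surface_def spacelike_curve_def timelike_curve_def by blast

text \<open>The arc is connected, lies in the section and passes through \<open>u\<close>.\<close>

lemma conic_arc_in_component:
  assumes S: "tubular_surface S" and s: "s \<in> dom_of S"
    and e: "lor e e = signal S" "lor (tangent S s) e = 0"
    and u: "u \<in> normal_section S s" "causal S s = 1 \<Longrightarrow> 0 < signal S * lor u e"
  shows "conic_arc (radius S) (tangent S s) e t \<in> connected_component_set (normal_section S s) u"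
proof -
  let ?arc = "conic_arc (radius S) (tangent S s) e"
  have T: "lor (tangent S s) (tangent S s) \<in> {-1, 1}"
    using tubular_surfaceD(4)[OF S s] by (simp add: causal_def)
  have "range ?arc \<subseteq> connected_component_set (normal_section S s) u"
  proof (rule connected_component_maximal)
    show "u \<in> range ?arc"
      using u tubular_surfaceD(2)[OF S]
      by (intro conic_arc_surj[OF T tubular_surfaceD(3)[OF S] e]) (auto simp: normal_section_def causal_def)
    show "connected (range ?arc)"
      by (intro connected_continuous_image continuous_on_conic_arc T connected_UNIV)
    show "range ?arc \<subseteq> normal_section S s"
      using lor_conic_arc[OF T tubular_surfaceD(3)[OF S] e] by (auto simp: normal_section_def)
  qed
  then show ?thesis by blast
qed

text \<open>Otherwise the product with \<open>e\<close> would vanish somewhere on the component, by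
  the intermediate value theorem, and it has no zero on the section.\<close>

lemma component_same_side:
  assumes S: "tubular_surface S" and s: "s \<in> dom_of S"
    and e: "lor e e = signal S" "lor (tangent S s) e = 0"
    and u: "connected_component (normal_section S s) u v" "0 < signal S * lor v e"
    and c: "causal S s = 1"
  shows "0 < signal S * lor u e"
proof (rule ccontr)
  let ?C = "connected_component_set (normal_section S s) u"
  let ?f = "\<lambda>u. signal S * lor u e"
  have T: "lor (tangent S s) (tangent S s) \<in> {-1, 1}"
    using tubular_surfaceD(4)[OF S s] by (simp add: causal_def)
  assume "\<not> 0 < ?f u"
  moreover have "connected (?f ` ?C)"
    by (intro connected_continuous_image continuous_intros lor.continuous_on connected_connected_component)
  moreover have "u \<in> ?C" "v \<in> ?C"
    using u(1) connected_component_in(1) connected_component_refl by auto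
  ultimately have "{?f u..?f v} \<subseteq> ?f ` ?C"
    by (intro connected_contains_Icc) (auto intro: imageI)
  moreover have "0 \<in> {?f u..?f v}" using \<open>\<not> 0 < ?f u\<close> u(2) by simp
  ultimately have "0 \<in> ?f ` ?C" by blast
  then obtain x where x: "x \<in> normal_section S s" "?f x = 0"
    by (auto dest: connected_component_in)
  have "lor x e \<noteq> 0"
    using x(1) c tubular_surfaceD(2)[OF S]
    by (intro section_lor_ne_0[OF T tubular_surfaceD(3)[OF S] e]) (auto simp: normal_section_def causal_def)
  then show False using x(2) tubular_surfaceD(3)[OF S] by auto
qed

text \<open>The frame is obtained by projecting the fixed vector \<open>v\<close> to the normal planes of nearby points.\<close>

lemma normal_frame_exists:
  assumes S: "tubular_surface S" and p: "(s, v) \<in> pairs S"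
  obtains I e where "open I" "s \<in> I" "I \<subseteq> dom_of S" "smooth_on I e"
    "\<And>x. x \<in> I \<Longrightarrow> lor (e x) (e x) = signal S" "\<And>x. x \<in> I \<Longrightarrow> lor (tangent S x) (e x) = 0"
    "radius S *\<^sub>R e s = v"
proof -
  let ?T = "tangent S" and ?\<epsilon> = "signal S" and ?r = "radius S"
  note S' = tubular_surfaceD[OF S]
  obtain \<tau> where \<tau>: "\<tau> \<in> {-1, 1}" "\<And>x. x \<in> dom_of S \<Longrightarrow> lor (?T x) (?T x) = \<tau>"
    using causal_const[OF S] by blast
  have s: "s \<in> dom_of S" by (rule S'(6)[OF p])
  \<comment> \<open>The projection of \<open>v\<close> to the normal plane at \<open>x\<close>; as
    the tangent has square \<open>\<tau>\<close>, the factor \<open>\<tau>\<close> replaces division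
    by it.\<close>
  define q where "q x = v + (- (\<tau> * lor v (?T x))) *\<^sub>R ?T x" for x
  define n where "n x = ?\<epsilon> * lor (q x) (q x)" for x
  define I where "I = {x \<in> dom_of S. 0 < n x}"
  define e where "e x = (n x powr (-1/2)) *\<^sub>R q x" for x
  have smT: "smooth_on (dom_of S) ?T" by (rule tubular_surface_smooth(1)[OF S])
  have "smooth_on (dom_of S) (\<lambda>x. (- \<tau>) * lor v (?T x))"
    by (intro bounded_bilinear.smooth_on[OF bounded_bilinear_mult] lor.smooth_on open_dom_of
        smooth_on_const smT)
  then have smq: "smooth_on (dom_of S) q"
    unfolding q_def[abs_def]
    by (intro smooth_on_add smooth_on_scaleR open_dom_of smooth_on_const smT) simp
  then have smn: "smooth_on (dom_of S) n"
    unfolding n_def[abs_def]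
    by (intro bounded_bilinear.smooth_on[OF bounded_bilinear_mult] lor.smooth_on open_dom_of
        smooth_on_const)
  have "I = dom_of S \<inter> n -` {0<..}" by (auto simp: I_def)
  then have I: "open I"
    using continuous_open_preimage[OF smooth_on_imp_continuous_on[OF smn] open_dom_of open_greaterThan]
    by simp
  have ID: "I \<subseteq> dom_of S" by (auto simp: I_def)
  have "smooth_on I (\<lambda>x. n x powr (-1/2))"
    by (rule smooth_on_compose_real[OF I open_greaterThan _ smooth_on_powr smooth_on_subset[OF smn ID]])
      (auto simp: I_def)
  then have sme: "smooth_on I e"
    unfolding e_def[abs_def] by (intro smooth_on_scaleR I smooth_on_subset[OF smq ID])
  have vT: "lor v (?T s) = 0" and vv: "lor v v = ?\<epsilon> * ?r\<^sup>2" using S'(7,8)[OF p] .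
  have r: "0 < ?r" by (rule S'(2))
  \<comment> \<open>At \<open>s\<close> the vector \<open>v\<close> is already normal, so
    \<open>q s = v\<close>; thus \<open>n\<close> is positive at \<open>s\<close> and
    \<open>e s\<close> is \<open>v\<close> divided by the radius.\<close>
  have ns: "n s = ?r\<^sup>2" using S'(3) by (auto simp: n_def q_def vT vv)
  have "?r *\<^sub>R e s = v"
    using r by (simp add: e_def ns q_def vT powr_minus powr_half_sqrt)
  moreover have "s \<in> I" using s r by (simp add: I_def ns)
  moreover have "lor (?T x) (e x) = 0" if "x \<in> I" for x
  proof -
    have "lor (?T x) (?T x) = \<tau>" using that ID \<tau>(2) by blast
    then show ?thesis using \<tau>(1)
      by (auto simp: e_def q_def lor_linear lor_commute)
  qed
  moreover have "lor (e x) (e x) = ?\<epsilon>" if "x \<in> I" for x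
  proof -
    have n: "0 < n x" using that by (simp add: I_def)
    have "lor (e x) (e x) = (n x powr (-1/2))\<^sup>2 * lor (q x) (q x)"
      by (simp add: e_def lor_linear power2_eq_square)
    also have "(n x powr (-1/2))\<^sup>2 = 1 / n x"
      using n by (simp add: powr_minus powr_half_sqrt power_inverse inverse_eq_divide power_divide)
    also have "lor (q x) (q x) = ?\<epsilon> * n x"
      using S'(3) by (auto simp: n_def)
    finally show ?thesis using n by simp
  qed
  ultimately show ?thesis using that[OF I _ ID sme] by blast
qed

text \<open>Over each \<open>x\<close> near \<open>s\<close> the conic arc of the frame vector
  \<open>e x\<close> is inserted. The whole arc over \<open>s\<close> is kept, since the curvatures
  are later compared along all of it.\<close>

lemma local_param_exists:
  assumes R: "regular_tubular S" and p: "(s, v) \<in> pairs S"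
  obtains V \<psi> e where "local_param S V \<psi>" "lor e e = signal S" "lor (tangent S s) e = 0"
    "radius S *\<^sub>R e = v"
    "\<And>t. (s, t) \<in> V \<and> \<psi> (s, t) = curve S s + conic_arc (radius S) (tangent S s) e t"
proof -
  have S: "tubular_surface S" using R by (simp add: regular_tubular_def)
  let ?T = "tangent S" and ?\<epsilon> = "signal S" and ?r = "radius S"
  note S' = tubular_surfaceD[OF S]
  obtain I e where I: "open I" "s \<in> I" "I \<subseteq> dom_of S" and sme: "smooth_on I e"
    and e: "\<And>x. x \<in> I \<Longrightarrow> lor (e x) (e x) = ?\<epsilon>" "\<And>x. x \<in> I \<Longrightarrow> lor (?T x) (e x) = 0"
    and es: "?r *\<^sub>R e s = v"
    by (rule normal_frame_exists[OF S p]) blast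
  obtain \<tau> where \<tau>: "\<tau> \<in> {-1, 1}" "\<And>x. x \<in> dom_of S \<Longrightarrow> lor (?T x) (?T x) = \<tau>"
    using causal_const[OF S] by blast
  have s: "s \<in> dom_of S" using I by blast
  have Tx: "lor (?T x) (?T x) \<in> {-1, 1}" if "x \<in> I" for x using that I(3) \<tau> by auto
  have "\<exists>J. open J \<and> s \<in> J \<and> J \<subseteq> I \<and> (\<forall>x\<in>J. \<forall>t. (x, conic_arc ?r (?T x) (e x) t) \<in> pairs S)"
  proof -
    consider "pairs S = (SIGMA s:dom_of S. normal_section S s)"
      | \<sigma> where "continuous_on (dom_of S) \<sigma>" "\<forall>s\<in>dom_of S. \<sigma> s \<in> normal_section S s"
        "pairs S = (SIGMA s:dom_of S. connected_component_set (normal_section S s) (\<sigma> s))"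
      using S unfolding tubular_surface_def by blast
    then show ?thesis
    proof cases
      case 1
      have "(x, conic_arc ?r (?T x) (e x) t) \<in> pairs S" if "x \<in> I" for x t
        using that I(3) lor_conic_arc[OF Tx[OF that] S'(3) e[OF that]]
        by (auto simp: 1 normal_section_def)
      with I show ?thesis by blast
    next
      case 2
      \<comment> \<open>For a spacelike curve, \<open>J\<close> keeps the points at which the frame
        vector is on the side of the chosen branch; around a timelike curve there is only one
        branch.\<close>
      define J where "J = {x \<in> I. \<tau> = 1 \<longrightarrow> 0 < ?\<epsilon> * lor (\<sigma> x) (e x)}"
      have "continuous_on I (\<lambda>x. ?\<epsilon> * lor (\<sigma> x) (e x))"
        by (intro continuous_intros lor.continuous_on continuous_on_subset[OF 2(1) I(3)]
            smooth_on_imp_continuous_on sme)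
      then have "open (I \<inter> (\<lambda>x. ?\<epsilon> * lor (\<sigma> x) (e x)) -` {0<..})"
        by (rule continuous_open_preimage[OF _ I(1) open_greaterThan])
      moreover have "J = (if \<tau> = 1 then I \<inter> (\<lambda>x. ?\<epsilon> * lor (\<sigma> x) (e x)) -` {0<..} else I)"
        by (auto simp: J_def)
      ultimately have "open J" using I(1) by simp
      moreover have "0 < ?\<epsilon> * lor (\<sigma> s) (e s)" if "\<tau> = 1"
      proof (rule component_same_side[OF S s e[OF I(2)]])
        show "connected_component (normal_section S s) (\<sigma> s) v" using p by (simp add: 2(3))
        show "causal S s = 1" using \<tau>(2)[OF s] that by (simp add: causal_def)
        have "?\<epsilon> * lor v (e s) = ?r"
          unfolding es[symmetric] using e(1)[OF I(2)] S'(3) by (auto simp: lor_linear)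
        then show "0 < ?\<epsilon> * lor v (e s)" using S'(2) by simp
      qed
      then have "s \<in> J" using I(2) by (simp add: J_def)
      moreover have "(x, conic_arc ?r (?T x) (e x) t) \<in> pairs S" if "x \<in> J" for x t
      proof -
        have x: "x \<in> I" "x \<in> dom_of S" using that I(3) by (auto simp: J_def)
        have "conic_arc ?r (?T x) (e x) t \<in> connected_component_set (normal_section S x) (\<sigma> x)"
          using 2(2) x that \<tau>(2)[OF x(2)] by (intro conic_arc_in_component S e) (auto simp: J_def causal_def)
        with x show ?thesis by (simp add: 2(3))
      qed
      ultimately show ?thesis by (intro exI[of _ J]) (auto simp: J_def)
    qed
  qed
  then obtain J where J: "open J" "s \<in> J" "J \<subseteq> I"
    and arc: "\<And>x t. x \<in> J \<Longrightarrow> (x, conic_arc ?r (?T x) (e x) t) \<in> pairs S" by blast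
  define V where "V = J \<times> (UNIV :: real set)"
  \<comment> \<open>Written with the constant \<open>\<tau>\<close> in place of the square of the
    tangent, so that \<open>cog \<tau>\<close> and \<open>sig \<tau>\<close> depend on the second
    coordinate only.\<close>
  define \<psi> where "\<psi> z = curve S (fst z) + ?r *\<^sub>R (cog \<tau> (snd z) *\<^sub>R e (fst z) +
    sig \<tau> (snd z) *\<^sub>R lcross (?T (fst z)) (e (fst z)))" for z
  have \<psi>: "\<psi> (x, t) = curve S x + conic_arc ?r (?T x) (e x) t" if "x \<in> J" for x t
    using \<tau>(2)[of x] that J(3) I(3) by (auto simp: \<psi>_def conic_arc_def)
  have V: "open V" using J(1) by (simp add: V_def open_Times)
  have along_fst: "smooth_on V (\<lambda>z. f (fst z))" if "smooth_on J f" for f :: "real \<Rightarrow> real^3"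
    by (rule smooth_on_compose_real[OF V J(1) _ that])
      (auto simp: V_def intro: smooth_on_bounded_linear V[unfolded V_def] bounded_linear_fst)
  have along_snd: "smooth_on V (\<lambda>z. f (snd z))" if "smooth_on UNIV f" for f :: "real \<Rightarrow> real"
    by (rule smooth_on_compose_real[OF V open_UNIV _ that])
      (auto intro: smooth_on_bounded_linear V bounded_linear_snd)
  have JD: "J \<subseteq> dom_of S" using J(3) I(3) by blast
  have "smooth_on V \<psi>"
    unfolding \<psi>_def[abs_def]
    by (intro smooth_on_add smooth_on_scaleR V smooth_on_const along_fst along_snd
        smooth_on_cog_sig \<tau>(1) bounded_bilinear.smooth_on[OF bounded_bilinear_lcross]
        smooth_on_subset[OF S'(1) JD] smooth_on_subset[OF tubular_surface_smooth(1)[OF S] JD]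
        smooth_on_subset[OF sme J(3)])
  with V arc have "lifts S V \<psi>" by (auto simp: lifts_def V_def \<psi>)
  moreover have "pd2 \<psi> z \<noteq> 0" if zV: "z \<in> V" for z
  proof -
    obtain x t where z: "z = (x, t)" "x \<in> J" "x \<in> I" using zV J(3) by (auto simp: V_def)
    define q where "q = ?r *\<^sub>R ((lor (?T x) (?T x) * sig (lor (?T x) (?T x)) t) *\<^sub>R e x
      + cog (lor (?T x) (?T x)) t *\<^sub>R lcross (?T x) (e x))"
    have "((\<lambda>t. curve S x + conic_arc ?r (?T x) (e x) t) has_vector_derivative q) (at t)"
      using has_vector_derivative_add[OF has_vector_derivative_const
          conic_arc_has_vector_derivative[OF Tx[OF z(3)]]]
      by (simp add: q_def)
    then have "pd2 \<psi> z = q"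
      using \<psi>[OF z(2)] by (simp add: pd2_def z(1) vector_derivative_at)
    moreover have "lor q q \<noteq> 0"
      using lor_conic_arc_deriv[OF Tx[OF z(3)] S'(3) e[OF z(3)] q_def] S'(2,3) Tx[OF z(3)] by auto
    ultimately show ?thesis by (auto simp: lor.zero_left)
  qed
  ultimately have "local_param S V \<psi>" using local_param_iff[OF R] by blast
  moreover have "(s, t) \<in> V \<and> \<psi> (s, t) = curve S s + conic_arc ?r (?T s) (e s) t" for t
    using J(2) \<psi> by (simp add: V_def)
  ultimately show ?thesis using that e[OF I(2)] es by blast
qed

text \<open>A local parametrization through \<open>p\<close> exists, and all of them give the same
  value; hence the definite descriptions are well defined.\<close>

lemma curvature_eq:
  assumes R: "regular_tubular S" and p: "p \<in> pairs S"
  shows "gauss_curvature S p = signal S * (1 - 1 / speed S p) / (radius S)\<^sup>2"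
    and "mean_curvature S p = signal S * (2 - 1 / speed S p) / (2 * radius S)"
proof -
  obtain s v where sv: "p = (s, v)" by force
  obtain V \<psi> e where L: "local_param S V \<psi>" "radius S *\<^sub>R e = v"
    "\<And>t. (s, t) \<in> V \<and> \<psi> (s, t) = curve S s + conic_arc (radius S) (tangent S s) e t"
    using local_param_exists[OF R p[unfolded sv]] by metis
  \<comment> \<open>At parameter 0 the arc passes through
    \<open>radius S *\<^sub>R e = v\<close>.\<close>
  have "param_at S p \<psi> (s, 0)"
    unfolding param_at_def using L(1) L(2) L(3)[of 0] by (auto simp: sv)
  moreover have "gauss_in S \<phi> z = signal S * (1 - 1 / speed S p) / (radius S)\<^sup>2"
    and "mean_in S \<phi> z = signal S * (2 - 1 / speed S p) / (2 * radius S)"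
    if "param_at S p \<phi> z" for \<phi> z
  proof -
    obtain W where "local_param S W \<phi>" "z \<in> W" "(fst z, \<phi> z - curve S (fst z)) = p"
      using \<open>param_at S p \<phi> z\<close> unfolding param_at_def by blast
    with curvature_in(3,4)[OF R this(1,2)]
    show "gauss_in S \<phi> z = signal S * (1 - 1 / speed S p) / (radius S)\<^sup>2"
      and "mean_in S \<phi> z = signal S * (2 - 1 / speed S p) / (2 * radius S)"
      by simp_all
  qed
  ultimately have "(\<exists>\<phi> z. param_at S p \<phi> z \<and> k = gauss_in S \<phi> z) \<longleftrightarrow>
      k = signal S * (1 - 1 / speed S p) / (radius S)\<^sup>2"
    and "(\<exists>\<phi> z. param_at S p \<phi> z \<and> k = mean_in S \<phi> z) \<longleftrightarrow>
      k = signal S * (2 - 1 / speed S p) / (2 * radius S)" for k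
    by metis+
  then show "gauss_curvature S p = signal S * (1 - 1 / speed S p) / (radius S)\<^sup>2"
    "mean_curvature S p = signal S * (2 - 1 / speed S p) / (2 * radius S)"
    by (simp_all add: gauss_curvature_def mean_curvature_def)
qed

text \<open>A single section suffices: along one arc over \<open>s\<close> the product with the
  acceleration takes infinitely many values, and \<open>speed\<close> is affine in it.\<close>

lemma infinite_speed:
  assumes R: "regular_tubular S" and s: "s \<in> dom_of S" and a: "accel S s \<noteq> 0"
  shows "infinite (speed S ` pairs S)"
proof
  assume fin: "finite (speed S ` pairs S)"
  have S: "tubular_surface S" using R by (simp add: regular_tubular_def)
  obtain v where p: "(s, v) \<in> pairs S" using pairs_nonempty[OF S s] by blast
  obtain V \<psi> e where L: "local_param S V \<psi>" and e: "lor e e = signal S" "lor (tangent S s) e = 0"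
    and \<psi>: "\<And>t. (s, t) \<in> V \<and> \<psi> (s, t) = curve S s + conic_arc (radius S) (tangent S s) e t"
    using local_param_exists[OF R p] by metis
  let ?arc = "conic_arc (radius S) (tangent S s) e"
  have c: "causal S s \<in> {-1, 1}" by (rule tubular_surfaceD(4)[OF S s])
  have "(s, ?arc t) \<in> pairs S" for t
    using L \<psi>[of t] unfolding local_param_def by (metis add_diff_cancel_left' fst_conv)
  \<comment> \<open>The definition of \<open>speed\<close> is solved for the product;
    \<open>causal S s\<close> is its own inverse.\<close>
  then have "lor (accel S s) (?arc t) \<in> (\<lambda>w. causal S s * (1 - w)) ` speed S ` pairs S" for t
    using c by (intro image_eqI[of _ _ "speed S (s, ?arc t)"] imageI) (auto simp: speed_def)
  then have "finite (range (\<lambda>t. lor (accel S s) (?arc t)))"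
    using finite_imageI[OF fin] by (auto intro: finite_subset)
  then show False
    using infinite_lor_conic_arc[OF _ tubular_surfaceD(3)[OF S] e tubular_surface_smooth(4)[OF S s] a
        tubular_surfaceD(2)[OF S]] c
    by (simp add: causal_def)
qed

section \<open>Polynomials vanishing on a line\<close>

text \<open>The univariate polynomial \<open>poly Q c\<close> is the restriction of \<open>Q\<close>
  to the graph of \<open>c\<close>.\<close>

lemma poly_poly_eq_eval2: "poly (poly Q c) x = eval2 Q x (poly c x)"
  by (induction Q) (simp_all add: eval2_def)

text \<open>Solved for \<open>y\<close>, the line is the graph of this polynomial, and the generator
  is the unit \<open>const2 (- 2 * r)\<close> times a monic linear factor in \<open>y\<close>. The
  claim is then the factor theorem over the polynomials in \<open>x\<close>.\<close>

lemma mem_principal_ideal_line_iff: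
  assumes "r \<noteq> 0"
  shows "Q \<in> principal_ideal (var_x * const2 (r\<^sup>2) - const2 (2 * r) * var_y + const2 \<epsilon>)
    \<longleftrightarrow> poly Q [:\<epsilon> / (2 * r), r / 2:] = 0"
proof -
  let ?c = "[:\<epsilon> / (2 * r), r / 2:]"
  let ?L = "var_x * const2 (r\<^sup>2) - const2 (2 * r) * var_y + const2 \<epsilon>"
  have L: "?L = const2 (- 2 * r) * [:- ?c, 1:]"
    using assms by (simp add: var_x_def var_y_def const2_def power2_eq_square)
  have 1: "const2 (- 1 / (2 * r)) * const2 (- 2 * r) = 1"
    using assms by (simp add: const2_def one_pCons)
  have "[:- ?c, 1:] dvd Q \<longleftrightarrow> Q \<in> principal_ideal ?L"
  proof
    assume "[:- ?c, 1:] dvd Q"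
    then obtain k where "Q = [:- ?c, 1:] * k" ..
    also have "\<dots> = (const2 (- 1 / (2 * r)) * const2 (- 2 * r)) * ([:- ?c, 1:] * k)"
      unfolding 1 by simp
    also have "\<dots> = (k * const2 (- 1 / (2 * r))) * ?L" unfolding L by (simp only: ac_simps)
    finally show "Q \<in> principal_ideal ?L" unfolding principal_ideal_def by blast
  next
    assume "Q \<in> principal_ideal ?L"
    then obtain p where "Q = p * ?L" unfolding principal_ideal_def by blast
    then show "[:- ?c, 1:] dvd Q" unfolding L by (simp only: dvd_mult dvd_triv_right)
  qed
  then show ?thesis by (simp add: poly_eq_0_iff_dvd)
qed

section \<open>The classification\<close>

theorem theorem18:
  fixes Q :: "real poly poly"
  shows "S_L Q =
    (\<Union>\<epsilon>\<in>{-1, 1}. {S. right_cylinder S \<and> signal S = \<epsilon> \<and> radius S \<in> Rad_L \<epsilon> Q}) \<union>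
    (\<Union>\<epsilon>\<in>{-1, 1}. {S. regular_tubular S \<and> signal S = \<epsilon> \<and> radius S \<in> Rad_L_star \<epsilon> Q})"
  (is "_ = ?C \<union> ?T")
proof -
  have iff: "S \<in> S_L Q \<longleftrightarrow> right_cylinder S \<and> radius S \<in> Rad_L (signal S) Q \<or>
      radius S \<in> Rad_L_star (signal S) Q" if R: "regular_tubular S" for S
  proof -
    let ?\<epsilon> = "signal S" and ?r = "radius S"
    let ?c = "[:?\<epsilon> / (2 * ?r), ?r / 2:]"
    define K where "K w = ?\<epsilon> * (1 - 1 / w) / ?r\<^sup>2" for w
    have S: "tubular_surface S" using R by (simp add: regular_tubular_def)
    have r: "0 < ?r" and \<epsilon>: "?\<epsilon> \<noteq> 0" using tubular_surfaceD(2,3)[OF S] by auto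
    have nd: "non_degenerate S"
      unfolding non_degenerate_def using curvature_in(2)[OF R] by blast
    have "eval2 Q (gauss_curvature S p) (mean_curvature S p) = poly (poly Q ?c) (K (speed S p))"
      if "p \<in> pairs S" for p
    proof -
      \<comment> \<open>The mean curvature is the value of the line at the Gaussian curvature
        \<open>K (speed S p)\<close>.\<close>
      have "poly ?c (K (speed S p)) = ?\<epsilon> * (2 - 1 / speed S p) / (2 * ?r)"
        using r speed_ne_0[OF R that] by (simp add: K_def field_simps power2_eq_square)
      then show ?thesis
        by (simp only: poly_poly_eq_eval2 curvature_eq[OF R that] K_def)
    qed
    with R nd have mem: "S \<in> S_L Q \<longleftrightarrow> (\<forall>p\<in>pairs S. poly (poly Q ?c) (K (speed S p)) = 0)"
      by (auto simp: S_L_def)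
    have K1: "poly (poly Q ?c) (K 1) = eval2 Q 0 (?\<epsilon> / (2 * ?r))"
      by (simp add: poly_poly_eq_eval2 K_def)
    have rad: "?r \<in> Rad_L ?\<epsilon> Q \<longleftrightarrow> poly (poly Q ?c) (K 1) = 0"
      using r K1 by (simp add: Rad_L_def)
    \<comment> \<open>If \<open>poly Q ?c\<close> is zero, so is its value at
      \<open>K 1 = 0\<close>; thus membership in \<open>Rad_L\<close> follows.\<close>
    have rad_star: "?r \<in> Rad_L_star ?\<epsilon> Q \<longleftrightarrow> poly Q ?c = 0"
      using r rad mem_principal_ideal_line_iff[of ?r Q ?\<epsilon>] by (auto simp: Rad_L_star_def)
    show ?thesis
    proof (cases "right_cylinder S")
      case True
      have "speed S p = 1" if "p \<in> pairs S" for p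
        using that True tubular_surfaceD(6)[OF S, of "fst p" "snd p"]
        by (simp add: right_cylinder_def speed_def lor.zero_left)
      moreover obtain s where "s \<in> dom_of S"
        using S unfolding tubular_surface_def dom_of_def
        by (metis einterval_nonempty ex_in_conv)
      \<comment> \<open>Without a point on the surface the curvature condition would be
        vacuous.\<close>
      then have "pairs S \<noteq> {}" using pairs_nonempty[OF S] by blast
      ultimately have "S \<in> S_L Q \<longleftrightarrow> poly (poly Q ?c) (K 1) = 0" using mem by auto
      with True rad rad_star show ?thesis by auto
    next
      case False
      then obtain s where "s \<in> dom_of S" "accel S s \<noteq> 0" using R by (auto simp: right_cylinder_def)
      then have "infinite (speed S ` pairs S)" by (rule infinite_speed[OF R])
      \<comment> \<open>Speeds are non-zero, so \<open>K\<close> is injective on them and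
        \<open>poly Q ?c\<close> gets infinitely many roots.\<close>
      moreover have "inj_on K (speed S ` pairs S)"
        using speed_ne_0[OF R] r \<epsilon> by (auto simp: inj_on_def K_def)
      ultimately have "infinite (K ` speed S ` pairs S)" by (simp add: finite_image_iff)
      then have "S \<in> S_L Q \<longleftrightarrow> poly Q ?c = 0"
        using mem poly_roots_finite[of "poly Q ?c"]
        by (auto dest: finite_subset[rotated, of _ "K ` speed S ` pairs S"])
      with False rad_star show ?thesis by auto
    qed
  qed
  show ?thesis
  proof (rule set_eqI)
    fix S
    show "S \<in> S_L Q \<longleftrightarrow> S \<in> ?C \<union> ?T"
    proof (cases "regular_tubular S")
      case True
      then have "signal S \<in> {-1, 1}" using tubular_surfaceD(3) by (auto simp: regular_tubular_def)
      with True iff[OF True] show ?thesis by auto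
    next
      case False
      then show ?thesis by (auto simp: S_L_def right_cylinder_def)
    qed
  qed
qed

end
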